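(* Let $\mathbf{k}$ be a field of characteristic zero, let $F_1,\dots,F_n\in\mathbf{k}[[\partial_1,\dots,\partial_n]]$ be formal power series, where $\partial_i=\partial/\partial x_i$, and let $\lambda,q_1,\dots,q_n$ be formal commuting variables. Let $K=(K_1,\dots,K_n)$, $K_j=K_j(\lambda,q_1,\dots,q_n)\in\mathbf{k}[[\lambda,q_1,\dots,q_n]]$ with zero constant term, be determined by $$e^{\sum_jK_j(\lambda,q)x_j}=e^{\lambda\sum_ix_iF_i(\partial)}\Bigl(e^{\sum_jq_jx_j}\Bigr).$$ Then for $j=1,\dots,n$ $$F_j(K(\lambda,q))=\sum_{i=1}^nF_i(q)\,\frac{\partial K_j}{\partial q_i}(\lambda,q)=\frac{\partial K_j}{\partial\lambda}(\lambda,q),$$ with the boundary condition $K(0,q)=q$.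
   Context: The operators $x_i$ (multiplication) and $\partial_i$ (differentiation) act on $\mathbf{k}[x_1,\dots,x_n]$; a formal power series in the $\partial_i$ acts on a polynomial through finitely many terms. The action is extended coefficientwise to $\mathbf{k}[x_1,\dots,x_n][[\lambda,q_1,\dots,q_n]]$, and $e^{\lambda\sum_ix_iF_i(\partial)}=\sum_{m\geq0}\frac{\lambda^m}{m!}\bigl(\sum_ix_iF_i(\partial)\bigr)^m$. $F_i(q)$ and $F_j(K)$ denote substitution of $q=(q_1,\dots,q_n)$, respectively of $K=(K_1,\dots,K_n)$, for $(\partial_1,\dots,\partial_n)$. The boundary condition $K(0,q)=q$ means $K_j(0,q)=q_j$. *)

theory Defs
  imports "HOL-Library.Poly_Mapping"
begin

text \<open>
  Formal power series over a commutative ring \<open>'a\<close>, with variables indexed by \<open>'v\<close>. An exponent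
  is a finitely supported function \<open>'v \<Rightarrow>\<^sub>0 nat\<close>; for finite \<open>'v\<close> these are all functions.
\<close>

typedef ('v, 'a) mps = "UNIV :: (('v \<Rightarrow>\<^sub>0 nat) \<Rightarrow> 'a) set"
  morphisms mps_nth Abs_mps ..

lemma mps_nth_Abs [simp]: "mps_nth (Abs_mps f) = f"
  by (simp add: Abs_mps_inverse)

lemma mps_eqI: "(\<And>c. mps_nth A c = mps_nth B c) \<Longrightarrow> A = B"
  by (metis ext mps_nth_inject)

lemma finite_exponent_splittings: "finite {(a, b). a + b = c}"
  for c :: "'v \<Rightarrow>\<^sub>0 nat"
proof -
  let ?B = "{f. \<forall>i. (i \<in> Poly_Mapping.keys c \<longrightarrow> f i \<in> {..Max (range (Poly_Mapping.lookup c))}) \<and>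
    (i \<notin> Poly_Mapping.keys c \<longrightarrow> f i = (0::nat))}"
  let ?g = "\<lambda>p. Poly_Mapping.lookup (fst p) :: 'v \<Rightarrow> nat"
  have "finite ?B"
    by (rule finite_set_of_finite_funs) auto
  moreover have "?g ` {(a, b). a + b = c} \<subseteq> ?B"
  proof (rule image_subsetI)
    fix p
    assume "p \<in> {(a, b). a + b = c}"
    then obtain a b where p: "p = (a, b)" and c: "c = a + b"
      by auto
    have "range (Poly_Mapping.lookup (a + b)) \<subseteq> insert 0 (Poly_Mapping.lookup (a + b) ` Poly_Mapping.keys (a + b))"
      by (auto simp: in_keys_iff)
    then have fin: "finite (range (Poly_Mapping.lookup (a + b)))"
      by (rule finite_subset) simp
    have "Poly_Mapping.lookup a i \<le> Max (range (Poly_Mapping.lookup (a + b)))" for i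
      using Max_ge[OF fin, of "Poly_Mapping.lookup (a + b) i"] by (simp add: lookup_add)
    then show "?g p \<in> ?B"
      by (auto simp: p c in_keys_iff lookup_add)
  qed
  ultimately have "finite (?g ` {(a, b). a + b = c})"
    by (rule finite_subset[rotated])
  moreover have "inj_on ?g {(a, b). a + b = c}"
    by (auto simp: inj_on_def)
  ultimately show ?thesis
    by (rule finite_imageD)
qed

instantiation mps :: (type, comm_ring_1) comm_ring_1
begin

definition zero_mps :: "('a, 'b) mps" where
  "0 = Abs_mps (\<lambda>_. 0)"

definition one_mps :: "('a, 'b) mps" where
  "1 = Abs_mps (\<lambda>c. if c = 0 then 1 else 0)"

definition plus_mps :: "('a, 'b) mps \<Rightarrow> ('a, 'b) mps \<Rightarrow> ('a, 'b) mps" where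
  "A + B = Abs_mps (\<lambda>c. mps_nth A c + mps_nth B c)"

definition minus_mps :: "('a, 'b) mps \<Rightarrow> ('a, 'b) mps \<Rightarrow> ('a, 'b) mps" where
  "A - B = Abs_mps (\<lambda>c. mps_nth A c - mps_nth B c)"

definition uminus_mps :: "('a, 'b) mps \<Rightarrow> ('a, 'b) mps" where
  "- A = Abs_mps (\<lambda>c. - mps_nth A c)"

definition times_mps :: "('a, 'b) mps \<Rightarrow> ('a, 'b) mps \<Rightarrow> ('a, 'b) mps" where
  "A * B = Abs_mps (\<lambda>c. \<Sum>(a, b) | a + b = c. mps_nth A a * mps_nth B b)"

instance
proof
  fix A B C :: "('a, 'b) mps"
  show "A * B * C = A * (B * C)"
  proof (rule mps_eqI)
    fix c
    let ?f = "\<lambda>x y z. mps_nth A x * mps_nth B y * mps_nth C z"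
    let ?S = "\<lambda>c. {(a, b). a + b = (c :: 'a \<Rightarrow>\<^sub>0 nat)}"
    have fin: "finite (?S d)" for d
      by (rule finite_exponent_splittings)
    have "mps_nth (A * B * C) c = (\<Sum>u\<in>?S c. \<Sum>v\<in>?S (fst u). ?f (fst v) (snd v) (snd u))"
      by (simp add: times_mps_def case_prod_unfold sum_distrib_right)
    also have "\<dots> = (\<Sum>(u, v)\<in>(SIGMA u:?S c. ?S (fst u)). ?f (fst v) (snd v) (snd u))"
      by (rule sum.Sigma) (use fin in auto)
    also have "\<dots> = (\<Sum>(u, v)\<in>(SIGMA u:?S c. ?S (snd u)). ?f (fst u) (fst v) (snd v))"
      by (rule sum.reindex_bij_witness[where
            i = "\<lambda>(u, v). ((fst u + fst v, snd v), (fst u, fst v))" and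
            j = "\<lambda>(u, v). ((fst v, snd v + snd u), (snd v, snd u))"])
        (auto simp: add.assoc)
    also have "\<dots> = (\<Sum>u\<in>?S c. \<Sum>v\<in>?S (snd u). ?f (fst u) (fst v) (snd v))"
      by (rule sum.Sigma[symmetric]) (use fin in auto)
    also have "\<dots> = mps_nth (A * (B * C)) c"
      by (simp add: times_mps_def case_prod_unfold sum_distrib_left mult.assoc)
    finally show "mps_nth (A * B * C) c = mps_nth (A * (B * C)) c" .
  qed
  show "A * B = B * A"
    unfolding times_mps_def
    by (rule arg_cong[where f = Abs_mps], rule ext,
        rule sum.reindex_bij_witness[where i = prod.swap and j = prod.swap])
      (auto simp: add.commute mult.commute)
  show "1 * A = A"
  proof (rule mps_eqI)
    fix c
    have "mps_nth (1 * A) c =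
        (\<Sum>(a, b) | a + b = c. if a = 0 then mps_nth A b else 0)"
      by (auto simp: times_mps_def one_mps_def intro!: sum.cong)
    also have "\<dots> = (\<Sum>(a, b)\<in>{(0 :: 'a \<Rightarrow>\<^sub>0 nat, c)}. if a = 0 then mps_nth A b else 0)"
      by (rule sum.mono_neutral_right) (auto simp: finite_exponent_splittings split: if_splits)
    finally show "mps_nth (1 * A) c = mps_nth A c"
      by simp
  qed
  show "(A + B) * C = A * C + B * C"
    by (simp add: times_mps_def plus_mps_def case_prod_unfold distrib_right sum.distrib)
  show "(0 :: ('a, 'b) mps) \<noteq> 1"
  proof
    assume "(0 :: ('a, 'b) mps) = 1"
    then have "mps_nth (0 :: ('a, 'b) mps) 0 = mps_nth 1 0"
      by simp
    then show False
      by (simp add: zero_mps_def one_mps_def)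
  qed
qed (simp_all add: plus_mps_def zero_mps_def minus_mps_def uminus_mps_def mps_nth_inverse add_ac)

end

definition mps_const :: "'a::comm_ring_1 \<Rightarrow> ('v, 'a) mps" where
  "mps_const r = Abs_mps (\<lambda>c. if c = 0 then r else 0)"

definition mps_var :: "'v \<Rightarrow> ('v, 'a::comm_ring_1) mps" where
  "mps_var i = Abs_mps (\<lambda>c. if c = Poly_Mapping.single i 1 then 1 else 0)"

definition mps_deriv :: "'v \<Rightarrow> ('v, 'a::comm_ring_1) mps \<Rightarrow> ('v, 'a) mps" where
  "mps_deriv i A =
     Abs_mps (\<lambda>c. of_nat (Poly_Mapping.lookup c i + 1) * mps_nth A (c + Poly_Mapping.single i 1))"

definition mps_map :: "('a \<Rightarrow> 'b) \<Rightarrow> ('v, 'a) mps \<Rightarrow> ('v, 'b) mps" where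
  "mps_map \<phi> A = Abs_mps (\<lambda>c. \<phi> (mps_nth A c))"

text \<open>
  Sum of a family of series in which each exponent receives only finitely many nonzero
  contributions. The constant \<^const>\<open>Sum_any\<close> sums over the support of its argument, so an
  exponent with infinitely many contributions gets the dummy coefficient 0; the families summed
  below are locally finite under the conditions stated there.
\<close>

definition mps_sum :: "('i \<Rightarrow> ('v, 'a::comm_ring_1) mps) \<Rightarrow> ('v, 'a) mps" where
  "mps_sum f = Abs_mps (\<lambda>c. Sum_any (\<lambda>i. mps_nth (f i) c))"

text \<open>
  Substitution \<open>A(G)\<close>. It is meaningful when finitely many variables are substituted and the
  series \<open>G v\<close> have zero constant term.
\<close>

definition mps_subst :: "('v, 'a::comm_ring_1) mps \<Rightarrow> ('v \<Rightarrow> ('w, 'a) mps) \<Rightarrow> ('w, 'a) mps" where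
  "mps_subst A G =
     mps_sum (\<lambda>a. mps_const (mps_nth A a) * (\<Prod>v\<in>Poly_Mapping.keys a. G v ^ Poly_Mapping.lookup a v))"


type_synonym ('n, 'a) mpoly = "('n \<Rightarrow>\<^sub>0 nat) \<Rightarrow>\<^sub>0 'a"

definition mpoly_const :: "'a::comm_ring_1 \<Rightarrow> ('n, 'a) mpoly" where
  "mpoly_const r = Poly_Mapping.single 0 r"

definition mpoly_var :: "'n \<Rightarrow> ('n, 'a::comm_ring_1) mpoly" where
  "mpoly_var i = Poly_Mapping.single (Poly_Mapping.single i 1) 1"

text \<open>For \<open>Poly_Mapping.lookup b i = 0\<close> the truncated exponent below comes with the coefficient 0.\<close>

definition mpoly_deriv :: "'n \<Rightarrow> ('n, 'a::comm_ring_1) mpoly \<Rightarrow> ('n, 'a) mpoly" where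
  "mpoly_deriv i p =
     (\<Sum>b\<in>Poly_Mapping.keys p. Poly_Mapping.single (b - Poly_Mapping.single i 1) (of_nat (Poly_Mapping.lookup b i) * Poly_Mapping.lookup p b))"

text \<open>The iterated derivative \<open>\<Prod>\<^sub>i \<partial>\<^sub>i\<^bsup>a i\<^esup>\<close>, as a composition of the commuting operators \<open>\<partial>\<^sub>i\<close>.\<close>

definition mpoly_derivs :: "('n \<Rightarrow>\<^sub>0 nat) \<Rightarrow> ('n, 'a::comm_ring_1) mpoly \<Rightarrow> ('n, 'a) mpoly" where
  "mpoly_derivs a p = Finite_Set.fold (\<lambda>i. mpoly_deriv i ^^ Poly_Mapping.lookup a i) p (Poly_Mapping.keys a)"

definition diff_op :: "('n, 'a::comm_ring_1) mps \<Rightarrow> ('n, 'a) mpoly \<Rightarrow> ('n, 'a) mpoly" where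
  "diff_op F p = Sum_any (\<lambda>a. mpoly_const (mps_nth F a) * mpoly_derivs a p)"

definition xF_op :: "('n::finite \<Rightarrow> ('n, 'a::comm_ring_1) mps) \<Rightarrow> ('n, 'a) mpoly \<Rightarrow> ('n, 'a) mpoly" where
  "xF_op F p = (\<Sum>i\<in>UNIV. mpoly_var i * diff_op (F i) p)"


datatype 'n lq = Lam | Q 'n

text \<open>
  The rings \<open>k[[\<lambda>,q]]\<close> and \<open>k[x][[\<lambda>,q]]\<close> are \<open>('n lq, 'a) mps\<close> and \<open>('n lq, ('n, 'a) mpoly) mps\<close>.
\<close>

text \<open>\<open>e\<^bsup>G\<^esup>\<close> for \<open>G\<close> in \<open>k[x][[\<lambda>,q]]\<close> without constant term in \<open>\<lambda>, q\<close>.\<close>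

definition mps_exp ::
    "('n lq, ('n, 'a::field_char_0) mpoly) mps \<Rightarrow> ('n lq, ('n, 'a) mpoly) mps" where
  "mps_exp G = mps_sum (\<lambda>m. mps_const (mpoly_const (1 / fact m)) * G ^ m)"

text \<open>\<open>e\<^bsup>\<lambda>D\<^esup>\<close> for an operator \<open>D\<close> on \<open>k[x]\<close>, extended coefficientwise.\<close>

definition exp_lambda_op ::
    "(('n, 'a::field_char_0) mpoly \<Rightarrow> ('n, 'a) mpoly) \<Rightarrow>
     ('n lq, ('n, 'a) mpoly) mps \<Rightarrow> ('n lq, ('n, 'a) mpoly) mps" where
  "exp_lambda_op D G =
     mps_sum (\<lambda>m. mps_const (mpoly_const (1 / fact m)) * mps_var Lam ^ m * (mps_map D ^^ m) G)"

definition lin_x ::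
    "('n::finite \<Rightarrow> ('n lq, 'a::comm_ring_1) mps) \<Rightarrow> ('n lq, ('n, 'a) mpoly) mps" where
  "lin_x A = (\<Sum>j\<in>UNIV. mps_map mpoly_const (A j) * mps_const (mpoly_var j))"

definition is_exponent ::
    "('n::finite \<Rightarrow> ('n, 'a::field_char_0) mps) \<Rightarrow> ('n \<Rightarrow> ('n lq, 'a) mps) \<Rightarrow> bool" where
  "is_exponent F K \<longleftrightarrow>
     (\<forall>j. mps_nth (K j) 0 = 0) \<and>
     mps_exp (lin_x K) = exp_lambda_op (xF_op F) (mps_exp (lin_x (\<lambda>j. mps_var (Q j))))"

end

theory Submission
  imports Defs
begin

text \<open>
  Let \<open>L = \<Sum>\<^sub>i F\<^sub>i(q) \<partial>/\<partial>q\<^sub>i\<close> and put \<open>K\<^sub>j = e\<^bsup>\<lambda>L\<^esup> q\<^sub>j\<close>. The operator \<open>\<partial>/\<partial>\<lambda> - L\<close> is a continuous derivation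
  and kills every \<open>K\<^sub>j\<close>, hence also \<open>e\<^bsup>\<Sum>\<^sub>j K\<^sub>j x\<^sub>j\<^esup>\<close> and \<open>F\<^sub>j(K)\<close>. Moreover \<open>D = \<Sum>\<^sub>i x\<^sub>i F\<^sub>i(\<partial>)\<close> commutes with \<open>L\<close> and
  satisfies \<open>D e\<^bsup>qx\<^esup> = L e\<^bsup>qx\<^esup>\<close>, so \<open>\<partial>/\<partial>\<lambda> - L\<close> kills \<open>e\<^bsup>\<lambda>D\<^esup> e\<^bsup>qx\<^esup>\<close> too. In characteristic zero an element
  of the kernel is determined by its restriction to \<open>\<lambda> = 0\<close>. Comparing restrictions gives
  \<open>e\<^bsup>\<Sum>\<^sub>j K\<^sub>j x\<^sub>j\<^esup> = e\<^bsup>\<lambda>D\<^esup> e\<^bsup>qx\<^esup>\<close> and, since \<open>L K\<^sub>j\<close> also lies in the kernel, \<open>F\<^sub>j(K) = L K\<^sub>j\<close>.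
\<close>

section \<open>Power series\<close>

lemma mps_nth_0 [simp]: "mps_nth 0 c = 0"
  by (simp add: zero_mps_def)

lemma mps_nth_1: "mps_nth 1 c = (if c = 0 then 1 else 0)"
  by (simp add: one_mps_def)

lemma mps_nth_add [simp]: "mps_nth (A + B) c = mps_nth A c + mps_nth B c"
  by (simp add: plus_mps_def)

lemma mps_nth_diff [simp]: "mps_nth (A - B) c = mps_nth A c - mps_nth B c"
  by (simp add: minus_mps_def)

lemma mps_nth_mult: "mps_nth (A * B) c = (\<Sum>p | fst p + snd p = c. mps_nth A (fst p) * mps_nth B (snd p))"
  by (simp add: times_mps_def case_prod_unfold)

lemma mps_nth_sum [simp]: "mps_nth (sum f S) c = (\<Sum>i\<in>S. mps_nth (f i) c)"
  by (induction S rule: infinite_finite_induct) auto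

lemma mps_nth_const: "mps_nth (mps_const r) c = (if c = 0 then r else 0)"
  by (simp add: mps_const_def)

lemma mps_nth_var: "mps_nth (mps_var i) c = (if c = Poly_Mapping.single i 1 then 1 else 0)"
  by (simp add: mps_var_def)

lemma mps_nth_var_0 [simp]: "mps_nth (mps_var i) 0 = 0"
  by (simp add: mps_nth_var) (metis lookup_single_eq lookup_zero nat.distinct(1))

lemma mps_nth_deriv:
  "mps_nth (mps_deriv i A) c = of_nat (Poly_Mapping.lookup c i + 1) * mps_nth A (c + Poly_Mapping.single i 1)"
  by (simp add: mps_deriv_def)

lemma mps_nth_map [simp]: "mps_nth (mps_map \<phi> A) c = \<phi> (mps_nth A c)"
  by (simp add: mps_map_def)

lemma mps_nth_mps_sum: "mps_nth (mps_sum f) c = Sum_any (\<lambda>i. mps_nth (f i) c)"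
  by (simp add: mps_sum_def)

lemma finite_splittings: "finite {p. fst p + snd p = c}" for c :: "'v \<Rightarrow>\<^sub>0 nat"
  using finite_exponent_splittings[of c] by (simp add: case_prod_unfold)

lemma mps_nth_const_mult [simp]:
  fixes A :: "('v, 'a::comm_ring_1) mps"
  shows "mps_nth (mps_const r * A) c = r * mps_nth A c"
proof -
  have "mps_nth (mps_const r * A) c = (\<Sum>p\<in>{(0, c)}. mps_nth (mps_const r :: ('v, 'a) mps) (fst p) * mps_nth A (snd p))"
    unfolding mps_nth_mult
    by (rule sum.mono_neutral_right) (auto simp: finite_splittings mps_nth_const)
  then show ?thesis by (simp add: mps_nth_const)
qed

lemma mps_const_0 [simp]: "mps_const 0 = 0"
  by (rule mps_eqI) (simp add: mps_nth_const)

lemma mps_const_1 [simp]: "mps_const 1 = 1"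
  by (rule mps_eqI) (simp add: mps_nth_const mps_nth_1)

lemma mps_const_mult: "mps_const (r * s) = mps_const r * mps_const s"
  by (rule mps_eqI) (simp add: mps_nth_const)

lemma mps_const_of_nat: "mps_const (of_nat m) = (of_nat m :: ('v, 'a::comm_ring_1) mps)"
proof (induction m)
  case (Suc m)
  have "mps_const (of_nat (Suc m)) = mps_const 1 + (mps_const (of_nat m) :: ('v, 'a) mps)"
    by (intro mps_eqI) (simp add: mps_nth_const del: mps_const_1)
  then show ?case by (simp only: Suc.IH mps_const_1 of_nat_Suc)
qed simp

subsection \<open>Order of a series\<close>

definition exponent_degree :: "('v::finite \<Rightarrow>\<^sub>0 nat) \<Rightarrow> nat" where
  "exponent_degree c = (\<Sum>v\<in>UNIV. Poly_Mapping.lookup c v)"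

text \<open>A lower bound for the order, not its exact value: the series lies in the
  \<open>n\<close>-th step of the filtration by total degree. This makes the bounds add up under
  products.\<close>

definition has_order :: "nat \<Rightarrow> ('v::finite, 'a::comm_ring_1) mps \<Rightarrow> bool" where
  "has_order n A \<longleftrightarrow> (\<forall>c. exponent_degree c < n \<longrightarrow> mps_nth A c = 0)"

lemma exponent_degree_0 [simp]: "exponent_degree 0 = 0"
  by (simp add: exponent_degree_def)

lemma exponent_degree_add [simp]: "exponent_degree (a + b) = exponent_degree a + exponent_degree b"
  by (simp add: exponent_degree_def lookup_add sum.distrib)

lemma exponent_degree_eq_0_iff: "exponent_degree c = 0 \<longleftrightarrow> c = 0"
  by (auto simp: exponent_degree_def intro: poly_mapping_eqI)

lemma finite_exponent_degree: "finite {c :: 'v::finite \<Rightarrow>\<^sub>0 nat. exponent_degree c \<le> n}"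
proof -
  have "Poly_Mapping.lookup c v \<le> exponent_degree c" for c :: "'v \<Rightarrow>\<^sub>0 nat" and v
    unfolding exponent_degree_def by (rule member_le_sum) auto
  then have "Poly_Mapping.lookup ` {c :: 'v \<Rightarrow>\<^sub>0 nat. exponent_degree c \<le> n} \<subseteq> {f. \<forall>v. (v \<in> UNIV \<longrightarrow> f v \<in> {..n}) \<and> (v \<notin> UNIV \<longrightarrow> f v = 0)}"
    using le_trans by fastforce
  then have "finite (Poly_Mapping.lookup ` {c :: 'v \<Rightarrow>\<^sub>0 nat. exponent_degree c \<le> n})"
    by (rule finite_subset) (rule finite_set_of_finite_funs, auto)
  then show ?thesis
    by (rule finite_imageD) (auto simp: inj_on_def)
qed

lemma has_order_0 [simp]: "has_order 0 A"
  by (simp add: has_order_def)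

lemma has_order_1_iff: "has_order (Suc 0) A \<longleftrightarrow> mps_nth A 0 = 0"
  by (auto simp: has_order_def exponent_degree_eq_0_iff)

lemma has_order_mult: "has_order m A \<Longrightarrow> has_order n B \<Longrightarrow> has_order (m + n) (A * B)"
  unfolding has_order_def
proof (intro allI impI)
  fix c :: "'a \<Rightarrow>\<^sub>0 nat"
  assume A: "\<forall>c. exponent_degree c < m \<longrightarrow> mps_nth A c = 0" and B: "\<forall>c. exponent_degree c < n \<longrightarrow> mps_nth B c = 0"
    and c: "exponent_degree c < m + n"
  have "mps_nth A (fst p) * mps_nth B (snd p) = 0" if "fst p + snd p = c" for p
  proof -
    from that c have "exponent_degree (fst p) < m \<or> exponent_degree (snd p) < n"
      by (auto simp flip: that)
    then show ?thesis using A B by auto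
  qed
  then show "mps_nth (A * B) c = 0"
    by (simp add: mps_nth_mult)
qed

lemma has_order_mult_left: "has_order n B \<Longrightarrow> has_order n (A * B)"
  using has_order_mult[of 0 A n B] by simp

lemma has_order_power: "has_order 1 A \<Longrightarrow> has_order m (A ^ m)"
proof (induction m)
  case (Suc m)
  then show ?case using has_order_mult[of 1 A m "A ^ m"] by simp
qed simp

lemma has_order_prod: "finite S \<Longrightarrow> (\<And>v. v \<in> S \<Longrightarrow> has_order (n v) (G v)) \<Longrightarrow> has_order (sum n S) (prod G S)"
  by (induction S rule: finite_induct) (auto intro: has_order_mult)

subsection \<open>Locally finite families\<close>

text \<open>The condition under which \<open>mps_sum\<close> is a genuine sum: no exponent falls
  back on the default value 0 of \<open>Sum_any\<close>.\<close>

definition locally_finite :: "('i \<Rightarrow> ('v, 'a::comm_ring_1) mps) \<Rightarrow> bool" where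
  "locally_finite f \<longleftrightarrow> (\<forall>c. finite {i. mps_nth (f i) c \<noteq> 0})"

lemma locally_finiteI_order:
  fixes f :: "'i \<Rightarrow> ('v::finite, 'a::comm_ring_1) mps"
  assumes "\<And>i. has_order (n i) (f i)" and "\<And>k. finite {i. n i \<le> k}"
  shows "locally_finite f"
  unfolding locally_finite_def
proof
  fix c
  have "{i. mps_nth (f i) c \<noteq> 0} \<subseteq> {i. n i \<le> exponent_degree c}"
    using assms(1) by (auto simp: has_order_def not_less[symmetric])
  then show "finite {i. mps_nth (f i) c \<noteq> 0}"
    using assms(2) finite_subset by blast
qed

lemma locally_finite_powers:
  fixes A :: "('v::finite, 'a::comm_ring_1) mps"
  assumes "mps_nth A 0 = 0"
  shows "locally_finite (\<lambda>m. B m * A ^ m)"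
  by (rule locally_finiteI_order[where n = "\<lambda>m. m"])
    (use assms in \<open>auto intro!: has_order_mult_left has_order_power simp: has_order_1_iff\<close>)

text \<open>Each \<open>G v\<close> has order at least 1, so the monomial with exponent
  \<open>a\<close> has order at least the total degree of \<open>a\<close>, and only finitely many
  exponents have bounded degree. Hence substitution into series without constant term is well
  defined.\<close>

lemma locally_finite_monomials:
  fixes G :: "'n::finite \<Rightarrow> ('v::finite, 'a::comm_ring_1) mps"
  assumes "\<And>v. mps_nth (G v) 0 = 0"
  shows "locally_finite (\<lambda>a. B a * (\<Prod>v\<in>Poly_Mapping.keys a. G v ^ Poly_Mapping.lookup a v))"
proof (rule locally_finiteI_order[where n = exponent_degree])
  fix a :: "'n \<Rightarrow>\<^sub>0 nat"
  have "has_order (\<Sum>v\<in>Poly_Mapping.keys a. Poly_Mapping.lookup a v) (\<Prod>v\<in>Poly_Mapping.keys a. G v ^ Poly_Mapping.lookup a v)"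
    by (rule has_order_prod) (use assms in \<open>auto intro!: has_order_power simp: has_order_1_iff\<close>)
  also have "(\<Sum>v\<in>Poly_Mapping.keys a. Poly_Mapping.lookup a v) = exponent_degree a"
    unfolding exponent_degree_def by (rule sum.mono_neutral_left) (auto simp: in_keys_iff)
  finally show "has_order (exponent_degree a) (B a * (\<Prod>v\<in>Poly_Mapping.keys a. G v ^ Poly_Mapping.lookup a v))"
    by (rule has_order_mult_left)
qed (rule finite_exponent_degree)

text \<open>Index shift for series differentiated term by term: term 0 dies and term
  \<open>Suc k\<close> turns into \<open>g k\<close>.\<close>

lemma mps_sum_case_nat: "mps_sum (case_nat 0 g) = mps_sum g"
proof (rule mps_eqI)
  fix c
  have "{i. mps_nth (case_nat 0 g i) c \<noteq> 0} = Suc ` {i. mps_nth (g i) c \<noteq> 0}"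
  proof (rule set_eqI)
    fix i
    show "i \<in> {i. mps_nth (case_nat 0 g i) c \<noteq> 0} \<longleftrightarrow> i \<in> Suc ` {i. mps_nth (g i) c \<noteq> 0}"
      by (cases i) auto
  qed
  then show "mps_nth (mps_sum (case_nat 0 g)) c = mps_nth (mps_sum g) c"
    by (simp add: mps_nth_mps_sum Sum_any.expand_set sum.reindex)
qed

lemma mps_sum_single:
  assumes "\<And>i. i \<noteq> k \<Longrightarrow> f i = 0"
  shows "mps_sum f = f k"
proof (rule mps_eqI)
  fix c
  have "(\<lambda>i. mps_nth (f i) c) = (\<lambda>i. if i = k then mps_nth (f i) c else 0)"
    using assms by fastforce
  then have "mps_nth (mps_sum f) c = Sum_any (\<lambda>i. if i = k then mps_nth (f i) c else 0)"
    by (simp only: mps_nth_mps_sum)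
  then show "mps_nth (mps_sum f) c = mps_nth (f k) c" by simp
qed

subsection \<open>Continuous additive maps\<close>

text \<open>Continuity for coefficientwise convergence with discrete coefficients: each output
  coefficient is controlled by finitely many input coefficients. For an additive map it is enough to
  say this at 0.\<close>

definition continuous_additive :: "(('v, 'a::comm_ring_1) mps \<Rightarrow> ('w, 'b::comm_ring_1) mps) \<Rightarrow> bool" where
  "continuous_additive d \<longleftrightarrow> (\<forall>A B. d (A + B) = d A + d B) \<and>
     (\<forall>c. \<exists>S. finite S \<and> (\<forall>A. (\<forall>b\<in>S. mps_nth A b = 0) \<longrightarrow> mps_nth (d A) c = 0))"

lemma continuous_additive_add: "continuous_additive d \<Longrightarrow> d (A + B) = d A + d B"
  by (auto simp: continuous_additive_def)

lemma continuous_additive_zero: "continuous_additive d \<Longrightarrow> d 0 = 0"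
  using continuous_additive_add[of d 0 0] by simp

lemma continuous_additive_diff: "continuous_additive d \<Longrightarrow> d (A - B) = d A - d B"
  using continuous_additive_add[of d "A - B" B] by simp

lemma continuous_additive_sum:
  "continuous_additive d \<Longrightarrow> d (sum f S) = (\<Sum>i\<in>S. d (f i))"
  by (induction S rule: infinite_finite_induct)
    (auto simp: continuous_additive_zero continuous_additive_add)

lemma continuous_additive_mps_sum:
  assumes d: "continuous_additive d" and f: "locally_finite f"
  shows "d (mps_sum f) = mps_sum (\<lambda>i. d (f i))"
proof (rule mps_eqI)
  fix c
  obtain S where S: "finite S" "\<And>A. (\<forall>b\<in>S. mps_nth A b = 0) \<Longrightarrow> mps_nth (d A) c = 0"
    using d unfolding continuous_additive_def by meson
  \<comment> \<open>The finitely many indices whose terms are visible on \<open>S\<close>. The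
    remainder \<open>mps_sum f - sum f I\<close> vanishes on \<open>S\<close>, so \<open>d\<close>
    of it has coefficient 0 at \<open>c\<close>, and the claim reduces to a finite sum.\<close>
  define I where "I = (\<Union>b\<in>S. {i. mps_nth (f i) b \<noteq> 0})"
  have I: "finite I" using S(1) f by (auto simp: I_def locally_finite_def)
  have "mps_nth (d (mps_sum f - sum f I)) c = 0"
  proof (rule S(2), rule ballI)
    fix b assume "b \<in> S"
    then have "{i. mps_nth (f i) b \<noteq> 0} \<subseteq> I" by (auto simp: I_def)
    then show "mps_nth (mps_sum f - sum f I) b = 0"
      by (simp add: mps_nth_mps_sum Sum_any.expand_superset[OF I])
  qed
  then have "mps_nth (d (mps_sum f)) c = (\<Sum>i\<in>I. mps_nth (d (f i)) c)"
    by (simp add: continuous_additive_diff[OF d] continuous_additive_sum[OF d])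
  also have "{i. mps_nth (d (f i)) c \<noteq> 0} \<subseteq> I"
    using S(2) by (fastforce simp: I_def)
  then have "(\<Sum>i\<in>I. mps_nth (d (f i)) c) = mps_nth (mps_sum (\<lambda>i. d (f i))) c"
    by (simp add: mps_nth_mps_sum Sum_any.expand_superset[OF I])
  finally show "mps_nth (d (mps_sum f)) c = mps_nth (mps_sum (\<lambda>i. d (f i))) c" .
qed

lemma continuous_additive_mult: "continuous_additive ((*) A)"
  unfolding continuous_additive_def
proof (intro conjI allI)
  fix c
  show "\<exists>S. finite S \<and> (\<forall>B. (\<forall>b\<in>S. mps_nth B b = 0) \<longrightarrow> mps_nth (A * B) c = 0)"
    by (rule exI[of _ "snd ` {p. fst p + snd p = c}"]) (auto simp: finite_splittings mps_nth_mult)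
qed (simp add: distrib_left)

lemma continuous_additive_deriv: "continuous_additive (mps_deriv i)"
  unfolding continuous_additive_def
proof (intro conjI allI)
  fix c
  show "\<exists>S. finite S \<and> (\<forall>B. (\<forall>b\<in>S. mps_nth B b = 0) \<longrightarrow> mps_nth (mps_deriv i B) c = 0)"
    by (rule exI[of _ "{c + Poly_Mapping.single i 1}"]) (auto simp: mps_nth_deriv)
qed (auto intro!: mps_eqI simp: mps_nth_deriv distrib_left)

lemma additive_zero:
  fixes \<phi> :: "'a::ab_group_add \<Rightarrow> 'b::ab_group_add"
  assumes "\<And>x y. \<phi> (x + y) = \<phi> x + \<phi> y"
  shows "\<phi> 0 = 0"
  using assms[of 0 0] by simp

lemma additive_sum:
  fixes \<phi> :: "'a::ab_group_add \<Rightarrow> 'b::ab_group_add"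
  assumes "\<And>x y. \<phi> (x + y) = \<phi> x + \<phi> y"
  shows "\<phi> (sum f S) = (\<Sum>i\<in>S. \<phi> (f i))"
  using additive_zero[of \<phi>] by (induction S rule: infinite_finite_induct) (auto simp: assms)

lemma continuous_additive_map:
  assumes "\<And>x y. \<phi> (x + y) = \<phi> x + \<phi> y"
  shows "continuous_additive (mps_map \<phi>)"
  unfolding continuous_additive_def
proof (intro conjI allI)
  fix c
  show "\<exists>S. finite S \<and> (\<forall>B. (\<forall>b\<in>S. mps_nth B b = 0) \<longrightarrow> mps_nth (mps_map \<phi> B) c = 0)"
    using additive_zero[of \<phi>] assms by (intro exI[of _ "{c}"]) auto
qed (auto intro!: mps_eqI simp: assms)

lemma continuous_additive_minus:
  assumes "continuous_additive d" "continuous_additive e"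
  shows "continuous_additive (\<lambda>A. d A - e A)"
  unfolding continuous_additive_def
proof (intro conjI allI)
  fix c
  obtain S T where "finite S" "\<And>A. (\<forall>b\<in>S. mps_nth A b = 0) \<Longrightarrow> mps_nth (d A) c = 0"
    and "finite T" "\<And>A. (\<forall>b\<in>T. mps_nth A b = 0) \<Longrightarrow> mps_nth (e A) c = 0"
    using assms unfolding continuous_additive_def by meson
  then show "\<exists>S. finite S \<and> (\<forall>A. (\<forall>b\<in>S. mps_nth A b = 0) \<longrightarrow> mps_nth (d A - e A) c = 0)"
    by (intro exI[of _ "S \<union> T"]) auto
qed (simp add: assms continuous_additive_add)

lemma continuous_additive_compose:
  assumes "continuous_additive d" "continuous_additive e"
  shows "continuous_additive (\<lambda>A. d (e A))"
  unfolding continuous_additive_def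
proof (intro conjI allI)
  fix c
  obtain S where S: "finite S" "\<And>A. (\<forall>b\<in>S. mps_nth A b = 0) \<Longrightarrow> mps_nth (d A) c = 0"
    using assms(1) unfolding continuous_additive_def by meson
  have "\<exists>T. finite T \<and> (\<forall>A. (\<forall>b\<in>T. mps_nth A b = 0) \<longrightarrow> mps_nth (e A) s = 0)" for s
    using assms(2) by (auto simp: continuous_additive_def)
  then obtain T where T: "\<And>s. finite (T s)" "\<And>s A. (\<forall>b\<in>T s. mps_nth A b = 0) \<Longrightarrow> mps_nth (e A) s = 0"
    by metis
  show "\<exists>S. finite S \<and> (\<forall>A. (\<forall>b\<in>S. mps_nth A b = 0) \<longrightarrow> mps_nth (d (e A)) c = 0)"
    by (rule exI[of _ "\<Union>(T ` S)"]) (auto simp: S(1) T(1) intro!: S(2) T(2))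
qed (simp add: assms continuous_additive_add)

lemma continuous_additive_Sum:
  assumes "\<And>i. i \<in> I \<Longrightarrow> continuous_additive (d i)" "finite I"
  shows "continuous_additive (\<lambda>A. \<Sum>i\<in>I. d i A)"
  unfolding continuous_additive_def
proof (intro conjI allI)
  fix c
  have "\<forall>i\<in>I. \<exists>T. finite T \<and> (\<forall>A. (\<forall>b\<in>T. mps_nth A b = 0) \<longrightarrow> mps_nth (d i A) c = 0)"
    using assms(1) by (auto simp: continuous_additive_def)
  then obtain T where T: "\<And>i. i \<in> I \<Longrightarrow> finite (T i)"
    "\<And>i A. i \<in> I \<Longrightarrow> (\<forall>b\<in>T i. mps_nth A b = 0) \<Longrightarrow> mps_nth (d i A) c = 0"
    by metis
  show "\<exists>S. finite S \<and> (\<forall>A. (\<forall>b\<in>S. mps_nth A b = 0) \<longrightarrow> mps_nth (\<Sum>i\<in>I. d i A) c = 0)"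
    by (rule exI[of _ "\<Union>(T ` I)"]) (auto simp: assms(2) T(1) intro!: sum.neutral T(2))
qed (simp add: assms continuous_additive_add sum.distrib)

subsection \<open>Derivations\<close>

text \<open>Only the Leibniz rule; additivity is supplied separately, mostly through
  \<open>continuous_additive\<close>.\<close>

definition derivation :: "('r::comm_ring_1 \<Rightarrow> 'r) \<Rightarrow> bool" where
  "derivation d \<longleftrightarrow> (\<forall>x y. d (x * y) = d x * y + x * d y)"

lemma derivation_mult: "derivation d \<Longrightarrow> d (x * y) = d x * y + x * d y"
  by (simp add: derivation_def)

lemma derivation_1: "derivation d \<Longrightarrow> d 1 = 0"
  using derivation_mult[of d 1 1] by simp

lemma derivation_power: "derivation d \<Longrightarrow> d (x ^ m) = of_nat m * x ^ (m - 1) * d x"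
proof (induction m)
  case (Suc m)
  then show ?case
    by (cases m) (auto simp: derivation_mult algebra_simps)
qed (simp add: derivation_1)

lemma derivation_prod_zero:
  assumes "derivation d" "\<And>v. v \<in> S \<Longrightarrow> d (f v) = 0"
  shows "d (prod f S) = 0"
  using assms(2) by (induction S rule: infinite_finite_induct)
    (auto simp: derivation_1[OF assms(1)] derivation_mult[OF assms(1)])

lemma derivation_minus: "derivation d \<Longrightarrow> derivation e \<Longrightarrow> derivation (\<lambda>x. d x - e x)"
  by (simp add: derivation_def algebra_simps)

lemma derivation_sum_scaled:
  "(\<And>i. i \<in> I \<Longrightarrow> derivation (d i)) \<Longrightarrow> derivation (\<lambda>x. \<Sum>i\<in>I. f i * d i x)"
  by (simp add: derivation_def distrib_left sum.distrib sum_distrib_left sum_distrib_right mult_ac)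

text \<open>For a splitting a + b of the exponent c + e, with e the unit exponent of
  \<open>i\<close>, the factor produced by differentiation is the sum of the \<open>i\<close>-th
  entries of a and b. The two summands give the two halves of the Leibniz rule.\<close>

lemma derivation_mps_deriv: "derivation (mps_deriv i :: ('v, 'a::comm_ring_1) mps \<Rightarrow> _)"
  unfolding derivation_def
proof (intro allI mps_eqI)
  fix A B :: "('v, 'a) mps" and c
  let ?e = "Poly_Mapping.single i (1::nat)"
  \<comment> \<open>Splittings whose first part has \<open>i\<close>-th entry 0 contribute nothing;
    the others correspond to splittings of \<open>c\<close> by removing \<open>?e\<close> from the
    first part.\<close>
  have half: "(\<Sum>p | fst p + snd p = c + ?e. of_nat (Poly_Mapping.lookup (fst p) i) * (mps_nth A (fst p) * mps_nth B (snd p)))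
      = mps_nth (mps_deriv i A * B) c" for A B :: "('v, 'a) mps"
  proof -
    have "(\<Sum>p | fst p + snd p = c + ?e. of_nat (Poly_Mapping.lookup (fst p) i) * (mps_nth A (fst p) * mps_nth B (snd p)))
      = (\<Sum>p | fst p + snd p = c + ?e \<and> Poly_Mapping.lookup (fst p) i > 0. of_nat (Poly_Mapping.lookup (fst p) i) * (mps_nth A (fst p) * mps_nth B (snd p)))"
      by (rule sum.mono_neutral_right) (auto simp: finite_splittings)
    also have "\<dots> = (\<Sum>p | fst p + snd p = c. mps_nth (mps_deriv i A) (fst p) * mps_nth B (snd p))"
    proof (rule sum.reindex_bij_witness[where i = "\<lambda>p. (fst p + ?e, snd p)" and j = "\<lambda>p. (fst p - ?e, snd p)"])
      fix p :: "('v \<Rightarrow>\<^sub>0 nat) \<times> ('v \<Rightarrow>\<^sub>0 nat)"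
      assume "p \<in> {p. fst p + snd p = c + ?e \<and> Poly_Mapping.lookup (fst p) i > 0}"
      then have p: "fst p + snd p = c + ?e" "Poly_Mapping.lookup (fst p) i > 0" by auto
      \<comment> \<open>Subtraction of exponents is truncated; positivity of the \<open>i\<close>-th
        entry makes it invertible here.\<close>
      have e: "fst p - ?e + ?e = fst p"
        by (rule poly_mapping_eqI) (use p(2) in \<open>auto simp: lookup_add lookup_minus lookup_single when_def\<close>)
      show "(fst (fst p - ?e, snd p) + ?e, snd (fst p - ?e, snd p)) = p"
        using e by simp
      have "(fst p - ?e + snd p) + ?e = c + ?e"
        using e p(1) by (simp add: algebra_simps)
      then show "(fst p - ?e, snd p) \<in> {p. fst p + snd p = c}" by simp
      have "Poly_Mapping.lookup (fst p - ?e) i + 1 = Poly_Mapping.lookup (fst p) i"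
        using p(2) by (simp add: lookup_minus)
      then show "mps_nth (mps_deriv i A) (fst (fst p - ?e, snd p)) * mps_nth B (snd (fst p - ?e, snd p)) =
          of_nat (Poly_Mapping.lookup (fst p) i) * (mps_nth A (fst p) * mps_nth B (snd p))"
        using e by (simp add: mps_nth_deriv mult.assoc del: of_nat_add of_nat_Suc)
    qed (auto simp: lookup_add lookup_single algebra_simps)
    finally show ?thesis by (simp add: mps_nth_mult)
  qed
  have swap: "(\<Sum>p | fst p + snd p = c + ?e. of_nat (Poly_Mapping.lookup (snd p) i) * (mps_nth A (fst p) * mps_nth B (snd p)))
      = (\<Sum>p | fst p + snd p = c + ?e. of_nat (Poly_Mapping.lookup (fst p) i) * (mps_nth B (fst p) * mps_nth A (snd p)))"
    by (rule sum.reindex_bij_witness[where i = prod.swap and j = prod.swap]) (auto simp: algebra_simps)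
  have "mps_nth (mps_deriv i (A * B)) c = (\<Sum>p | fst p + snd p = c + ?e. of_nat (Poly_Mapping.lookup (c + ?e) i) * (mps_nth A (fst p) * mps_nth B (snd p)))"
    by (simp add: mps_nth_deriv mps_nth_mult sum_distrib_left lookup_add)
  also have "\<dots> = (\<Sum>p | fst p + snd p = c + ?e. of_nat (Poly_Mapping.lookup (fst p) i) * (mps_nth A (fst p) * mps_nth B (snd p))
      + of_nat (Poly_Mapping.lookup (snd p) i) * (mps_nth A (fst p) * mps_nth B (snd p)))"
  proof (rule sum.cong)
    fix p assume "p \<in> {p. fst p + snd p = c + ?e}"
    then have "of_nat (Poly_Mapping.lookup (c + ?e) i) = (of_nat (Poly_Mapping.lookup (fst p) i) + of_nat (Poly_Mapping.lookup (snd p) i) :: 'a)"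
      by (metis (mono_tags, lifting) lookup_add mem_Collect_eq of_nat_add)
    then show "of_nat (Poly_Mapping.lookup (c + ?e) i) * (mps_nth A (fst p) * mps_nth B (snd p)) =
       of_nat (Poly_Mapping.lookup (fst p) i) * (mps_nth A (fst p) * mps_nth B (snd p))
      + of_nat (Poly_Mapping.lookup (snd p) i) * (mps_nth A (fst p) * mps_nth B (snd p))"
      by (simp only: distrib_right)
  qed simp
  also have "\<dots> = mps_nth (mps_deriv i A * B) c + mps_nth (mps_deriv i B * A) c"
    by (simp only: sum.distrib swap half)
  finally show "mps_nth (mps_deriv i (A * B)) c = mps_nth (mps_deriv i A * B + A * mps_deriv i B) c"
    by (simp add: mult.commute)
qed

lemma mps_deriv_const [simp]: "mps_deriv i (mps_const r) = 0"
proof (rule mps_eqI)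
  fix c
  have "c + Poly_Mapping.single i 1 \<noteq> (0 :: 'a \<Rightarrow>\<^sub>0 nat)"
    by (metis add_is_0 lookup_add lookup_single_eq lookup_zero one_neq_zero)
  then show "mps_nth (mps_deriv i (mps_const r)) c = mps_nth 0 c"
    by (simp add: mps_nth_deriv mps_nth_const)
qed

lemma mps_deriv_var: "mps_deriv i (mps_var j) = (if i = j then 1 else 0)"
proof (rule mps_eqI)
  fix c :: "'a \<Rightarrow>\<^sub>0 nat"
  have "c + Poly_Mapping.single i 1 = Poly_Mapping.single j 1 \<longleftrightarrow> i = j \<and> c = 0"
  proof
    assume e: "c + Poly_Mapping.single i 1 = Poly_Mapping.single j 1"
    from e have "Poly_Mapping.lookup (c + Poly_Mapping.single i 1) i = Poly_Mapping.lookup (Poly_Mapping.single j 1) i" by simp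
    then have "i = j" by (auto simp: lookup_add lookup_single when_def split: if_splits)
    then show "i = j \<and> c = 0" using e by simp
  qed auto
  then show "mps_nth (mps_deriv i (mps_var j)) c = mps_nth (if i = j then 1 else 0) c"
    by (auto simp: mps_nth_deriv mps_nth_var mps_nth_1)
qed

lemma mps_deriv_commute: "mps_deriv i (mps_deriv j A) = mps_deriv j (mps_deriv i A)"
proof (rule mps_eqI)
  fix c
  show "mps_nth (mps_deriv i (mps_deriv j A)) c = mps_nth (mps_deriv j (mps_deriv i A)) c"
  proof (cases "i = j")
    case False
    then show ?thesis
      by (simp add: mps_nth_deriv lookup_add lookup_single add.assoc add.commute[of "Poly_Mapping.single i (Suc 0)"] mult.left_commute[of "of_nat (Poly_Mapping.lookup c i + 1)"] del: of_nat_add of_nat_Suc)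
  qed simp
qed

lemma mps_deriv_map:
  assumes "\<And>x y. \<phi> (x + y) = \<phi> x + \<phi> y"
  shows "mps_deriv i (mps_map \<phi> A) = mps_map \<phi> (mps_deriv i A)"
proof -
  have "\<phi> (of_nat m * x) = of_nat m * \<phi> x" for m x
    using additive_zero[of \<phi>] by (induction m) (auto simp: assms distrib_right)
  then show ?thesis by (intro mps_eqI) (simp add: mps_nth_deriv del: of_nat_add of_nat_Suc)
qed

subsection \<open>Coefficient maps\<close>

lemma mps_map_mult:
  assumes "\<And>x y. \<phi> (x + y) = \<phi> x + \<phi> y" "\<And>x y. \<phi> (x * y) = \<phi> x * \<phi> y"
  shows "mps_map \<phi> (A * B) = mps_map \<phi> A * mps_map \<phi> B"
  by (rule mps_eqI) (simp add: mps_nth_mult additive_sum[of \<phi>] assms)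

lemma mps_map_1: "\<phi> 0 = 0 \<Longrightarrow> \<phi> 1 = 1 \<Longrightarrow> mps_map \<phi> 1 = 1"
  by (rule mps_eqI) (simp add: mps_nth_1)

lemma mps_map_const: "\<phi> 0 = 0 \<Longrightarrow> mps_map \<phi> (mps_const r) = mps_const (\<phi> r)"
  by (rule mps_eqI) (simp add: mps_nth_const)

lemma mps_map_var: "\<phi> 0 = 0 \<Longrightarrow> \<phi> 1 = 1 \<Longrightarrow> mps_map \<phi> (mps_var r) = mps_var r"
  by (rule mps_eqI) (simp add: mps_nth_var)

lemma mps_map_power:
  assumes "\<And>x y. \<phi> (x + y) = \<phi> x + \<phi> y" "\<And>x y. \<phi> (x * y) = \<phi> x * \<phi> y" "\<phi> 1 = 1"
  shows "mps_map \<phi> (A ^ m) = mps_map \<phi> A ^ m"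
  by (induction m) (auto simp: mps_map_mult[of \<phi>] mps_map_1[of \<phi>] additive_zero[of \<phi>] assms)

text \<open>With \<open>\<phi>\<close> the embedding of scalars, this extends linearity of
  \<open>\<delta>\<close> over constants to linearity over series with constant coefficients. It is
  applied to \<open>mpoly_deriv i\<close> and \<open>xF_op F\<close>, with
  \<open>mpoly_const\<close> as \<open>\<phi>\<close>.\<close>

lemma mps_map_additive_mult:
  assumes "\<And>x y. \<delta> (x + y) = \<delta> x + \<delta> y" "\<And>r x. \<delta> (\<phi> r * x) = \<phi> r * \<delta> x"
  shows "mps_map \<delta> (mps_map \<phi> A * B) = mps_map \<phi> A * mps_map \<delta> B"
  by (rule mps_eqI) (simp add: mps_nth_mult additive_sum[of \<delta>] assms)

lemma derivation_mps_map:
  assumes "\<And>x y. \<delta> (x + y) = \<delta> x + \<delta> y" "derivation \<delta>"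
  shows "derivation (mps_map \<delta>)"
  unfolding derivation_def
  by (intro allI mps_eqI)
    (simp add: mps_nth_mult additive_sum[of \<delta>, OF assms(1)] derivation_mult[OF assms(2)] sum.distrib)

section \<open>Polynomials\<close>

text \<open>Reading a polynomial as a power series transfers the product and Leibniz computations
  from series to polynomials.\<close>

lemma lookup_mpoly_mult:
  "Poly_Mapping.lookup (p * q) c = mps_nth (Abs_mps (Poly_Mapping.lookup p) * Abs_mps (Poly_Mapping.lookup q)) c"
  for p q :: "('n, 'a::comm_ring_1) mpoly"
proof -
  have eq: "(\<lambda>(a, b). Poly_Mapping.lookup p a * Poly_Mapping.lookup q b when c = a + b) =
      (\<lambda>x. if fst x + snd x = c then Poly_Mapping.lookup p (fst x) * Poly_Mapping.lookup q (snd x) else 0)"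
    by (auto simp: fun_eq_iff when_def)
  have "Poly_Mapping.lookup (p * q) c = (\<Sum>x | fst x + snd x = c.
      Poly_Mapping.lookup p (fst x) * Poly_Mapping.lookup q (snd x))"
    unfolding times_poly_mapping.rep_eq
    by (subst prod_fun_unfold_prod) (auto simp: eq Sum_any.conditionalize[OF finite_splittings])
  also have "\<dots> = mps_nth (Abs_mps (Poly_Mapping.lookup p) * Abs_mps (Poly_Mapping.lookup q)) c"
    by (simp add: mps_nth_mult)
  finally show ?thesis .
qed

lemma lookup_mpoly_const_mult [simp]:
  fixes p :: "('n, 'a::comm_ring_1) mpoly"
  shows "Poly_Mapping.lookup (mpoly_const r * p) c = r * Poly_Mapping.lookup p c"
proof -
  have "Abs_mps (Poly_Mapping.lookup (mpoly_const r)) = (mps_const r :: ('n, 'a) mps)"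
    by (rule mps_eqI) (auto simp: mpoly_const_def mps_nth_const lookup_single when_def)
  then show ?thesis by (simp add: lookup_mpoly_mult)
qed

lemma mpoly_const_0 [simp]: "mpoly_const 0 = 0"
  by (simp add: mpoly_const_def)

lemma mpoly_const_1 [simp]: "mpoly_const 1 = 1"
  by (simp add: mpoly_const_def)

lemma mpoly_const_add: "mpoly_const (r + s) = mpoly_const r + mpoly_const s"
  by (simp add: mpoly_const_def single_add)

lemma mpoly_const_mult: "mpoly_const (r * s) = mpoly_const r * mpoly_const s"
  by (simp add: mpoly_const_def mult_single)

lemma mpoly_const_of_nat: "mpoly_const (of_nat m) = of_nat m"
  by (induction m) (simp_all add: mpoly_const_add)

text \<open>Characteristic zero passes to the polynomial ring coefficient by coefficient. This is
  the cancellation hypothesis of \<open>transport_defect_unique\<close> for series over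
  k[x].\<close>

lemma of_nat_Suc_mult_mpoly_eq_0D:
  fixes p :: "('n, 'a::field_char_0) mpoly"
  assumes "of_nat (Suc m) * p = 0"
  shows "p = 0"
proof (rule poly_mapping_eqI)
  fix c
  have "Poly_Mapping.lookup (mpoly_const (of_nat (Suc m)) * p) c = 0"
    using assms by (simp only: mpoly_const_of_nat lookup_zero)
  then show "Poly_Mapping.lookup p c = Poly_Mapping.lookup 0 c"
    by (simp del: of_nat_Suc)
qed

text \<open>The exponent 0 splits only as 0 + 0. Thus evaluation at x = 0 is multiplicative.\<close>

lemma lookup_mult_0:
  "Poly_Mapping.lookup (p * q) 0 = Poly_Mapping.lookup p 0 * Poly_Mapping.lookup q (0 :: 'n \<Rightarrow>\<^sub>0 nat)"
  for p q :: "('n, 'a::comm_ring_1) mpoly"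
proof -
  have "a + b = 0 \<longleftrightarrow> a = 0 \<and> b = 0" for a b :: "'n \<Rightarrow>\<^sub>0 nat"
    by (auto simp: poly_mapping_eq_iff fun_eq_iff lookup_add)
  then have "{p. fst p + snd p = (0 :: 'n \<Rightarrow>\<^sub>0 nat)} = {(0, 0)}" by auto
  then show ?thesis by (simp add: lookup_mpoly_mult mps_nth_mult)
qed

lemma lookup_sum_poly_mapping: "Poly_Mapping.lookup (sum f S) c = (\<Sum>i\<in>S. Poly_Mapping.lookup (f i) c)"
  by (induction S rule: infinite_finite_induct) (auto simp: lookup_add)

lemma lookup_mpoly_deriv:
  "Poly_Mapping.lookup (mpoly_deriv i p) c =
    of_nat (Poly_Mapping.lookup c i + 1) * Poly_Mapping.lookup p (c + Poly_Mapping.single i 1)"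
proof -
  let ?e = "Poly_Mapping.single i (1::nat)"
  have "Poly_Mapping.lookup (mpoly_deriv i p) c =
    (\<Sum>b\<in>Poly_Mapping.keys p. if b = c + ?e then of_nat (Poly_Mapping.lookup b i) * Poly_Mapping.lookup p b else 0)"
    unfolding mpoly_deriv_def lookup_sum_poly_mapping
  proof (rule sum.cong)
    fix b
    show "Poly_Mapping.lookup (Poly_Mapping.single (b - ?e) (of_nat (Poly_Mapping.lookup b i) * Poly_Mapping.lookup p b)) c =
        (if b = c + ?e then of_nat (Poly_Mapping.lookup b i) * Poly_Mapping.lookup p b else 0)"
    \<comment> \<open>If \<open>b\<close> has \<open>i\<close>-th entry 0, the truncated difference
      \<open>b - ?e\<close> may equal \<open>c\<close>, but its coefficient is 0 and
      \<open>b\<close> cannot be \<open>c + ?e\<close>.\<close>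
    proof (cases "Poly_Mapping.lookup b i = 0")
      case False
      then have "b - ?e + ?e = b"
        by (intro poly_mapping_eqI) (auto simp: lookup_add lookup_minus lookup_single when_def)
      then have "b - ?e = c \<longleftrightarrow> b = c + ?e" by (metis add_diff_cancel_right')
      then show ?thesis by (simp add: lookup_single when_def)
    qed (auto simp: lookup_add)
  qed simp
  also have "\<dots> = of_nat (Poly_Mapping.lookup c i + 1) * Poly_Mapping.lookup p (c + ?e)"
    by (auto simp: in_keys_iff lookup_add)
  finally show ?thesis .
qed

lemma Abs_mps_mpoly_deriv: "Abs_mps (Poly_Mapping.lookup (mpoly_deriv i p)) = mps_deriv i (Abs_mps (Poly_Mapping.lookup p))"
  by (rule mps_eqI) (simp add: mps_nth_deriv lookup_mpoly_deriv)

lemma mpoly_deriv_add: "mpoly_deriv i (p + q) = mpoly_deriv i p + mpoly_deriv i q"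
  by (rule poly_mapping_eqI) (simp add: lookup_mpoly_deriv lookup_add distrib_left)

lemma derivation_mpoly_deriv: "derivation (mpoly_deriv i)"
  unfolding derivation_def
proof (intro allI poly_mapping_eqI)
  fix p q :: "('a, 'b) mpoly" and c
  show "Poly_Mapping.lookup (mpoly_deriv i (p * q)) c = Poly_Mapping.lookup (mpoly_deriv i p * q + p * mpoly_deriv i q) c"
    unfolding lookup_add lookup_mpoly_mult Abs_mps_mpoly_deriv mps_nth_add[symmetric]
      derivation_mult[OF derivation_mps_deriv, symmetric]
    by (simp add: lookup_mpoly_deriv lookup_mpoly_mult mps_nth_deriv)
qed

lemma mpoly_deriv_const [simp]: "mpoly_deriv i (mpoly_const r) = 0"
  by (simp add: mpoly_deriv_def mpoly_const_def)

lemma mpoly_deriv_var: "mpoly_deriv i (mpoly_var j) = (if i = j then 1 else 0)"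
  by (simp add: mpoly_deriv_def mpoly_var_def lookup_single when_def)

lemma mpoly_deriv_const_mult: "mpoly_deriv i (mpoly_const r * p) = mpoly_const r * mpoly_deriv i p"
  by (simp add: derivation_mult[OF derivation_mpoly_deriv])

section \<open>Iterated derivatives and power series in them as operators on polynomials\<close>

lemma mpoly_deriv_commute: "mpoly_deriv i (mpoly_deriv j p) = mpoly_deriv j (mpoly_deriv i p)"
proof -
  have "Abs_mps (Poly_Mapping.lookup (mpoly_deriv i (mpoly_deriv j p))) = Abs_mps (Poly_Mapping.lookup (mpoly_deriv j (mpoly_deriv i p)))"
    by (simp only: Abs_mps_mpoly_deriv mps_deriv_commute)
  then show ?thesis by (metis mps_nth_Abs poly_mapping.lookup_inject)
qed

text \<open>Makes the fold in \<open>mpoly_derivs\<close> independent of the order of the variables,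
  so that it unfolds along insertion.\<close>

lemma comp_fun_commute_mpoly_derivs:
  "comp_fun_commute (\<lambda>i. (mpoly_deriv i :: ('n, 'a::comm_ring_1) mpoly \<Rightarrow> _) ^^ Poly_Mapping.lookup a i)"
proof -
  interpret comp_fun_commute "mpoly_deriv :: 'n \<Rightarrow> ('n, 'a) mpoly \<Rightarrow> _"
    by standard (auto simp: fun_eq_iff intro: mpoly_deriv_commute)
  show ?thesis by (rule comp_fun_commute_funpow)
qed

text \<open>\<open>C c\<close> is a product of rising factorials, but its existence suffices:
  linearity of \<open>mpoly_derivs a\<close> and the vanishing of almost all derivatives of a
  polynomial follow from this shape.\<close>

lemma lookup_mpoly_derivs:
  fixes a :: "'n \<Rightarrow>\<^sub>0 nat"
  shows "\<exists>C. \<forall>p :: ('n, 'a::comm_ring_1) mpoly. \<forall>c.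
    Poly_Mapping.lookup (mpoly_derivs a p) c = of_nat (C c) * Poly_Mapping.lookup p (c + a)"
proof -
  interpret comp_fun_commute "\<lambda>i. (mpoly_deriv i :: ('n, 'a) mpoly \<Rightarrow> _) ^^ Poly_Mapping.lookup a i"
    by (rule comp_fun_commute_mpoly_derivs)
  have pow: "\<exists>C. \<forall>p :: ('n, 'a) mpoly. \<forall>c.
    Poly_Mapping.lookup ((mpoly_deriv i ^^ m) p) c = of_nat (C c) * Poly_Mapping.lookup p (c + Poly_Mapping.single i m)" for i m
  proof (induction m)
    case 0
    then show ?case by (intro exI[of _ "\<lambda>_. 1"]) simp
  next
    case (Suc m)
    then obtain C where C: "\<And>p :: ('n, 'a) mpoly. \<And>c. Poly_Mapping.lookup ((mpoly_deriv i ^^ m) p) c =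
        of_nat (C c) * Poly_Mapping.lookup p (c + Poly_Mapping.single i m)" by blast
    have "Poly_Mapping.single i (Suc m) = Poly_Mapping.single i 1 + Poly_Mapping.single i m"
      by (simp flip: single_add)
    then show ?case
      by (intro exI[of _ "\<lambda>c. (Poly_Mapping.lookup c i + 1) * C (c + Poly_Mapping.single i 1)"])
        (simp only: funpow.simps comp_apply lookup_mpoly_deriv C of_nat_mult add.assoc mult.assoc simp_thms)
  qed
  have "\<exists>C. \<forall>p :: ('n, 'a) mpoly. \<forall>c.
    Poly_Mapping.lookup (Finite_Set.fold (\<lambda>i. mpoly_deriv i ^^ Poly_Mapping.lookup a i) p S) c =
      of_nat (C c) * Poly_Mapping.lookup p (c + (\<Sum>i\<in>S. Poly_Mapping.single i (Poly_Mapping.lookup a i)))" if "finite S" for S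
    using that
  proof (induction S rule: finite_induct)
    case empty
    then show ?case by (intro exI[of _ "\<lambda>_. 1"]) simp
  next
    case (insert i S)
    obtain C where C: "\<And>p :: ('n, 'a) mpoly. \<And>c. Poly_Mapping.lookup (Finite_Set.fold (\<lambda>i. mpoly_deriv i ^^ Poly_Mapping.lookup a i) p S) c =
      of_nat (C c) * Poly_Mapping.lookup p (c + (\<Sum>i\<in>S. Poly_Mapping.single i (Poly_Mapping.lookup a i)))"
      using insert.IH by blast
    obtain B where B: "\<And>p :: ('n, 'a) mpoly. \<And>c. Poly_Mapping.lookup ((mpoly_deriv i ^^ Poly_Mapping.lookup a i) p) c =
      of_nat (B c) * Poly_Mapping.lookup p (c + Poly_Mapping.single i (Poly_Mapping.lookup a i))"
      using pow by blast
    show ?case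
      by (intro exI[of _ "\<lambda>c. B c * C (c + Poly_Mapping.single i (Poly_Mapping.lookup a i))"])
        (simp add: insert.hyps B C add.assoc mult.assoc)
  qed
  from this[of "Poly_Mapping.keys a"] have "\<exists>C. \<forall>p :: ('n, 'a) mpoly. \<forall>c.
    Poly_Mapping.lookup (mpoly_derivs a p) c =
      of_nat (C c) * Poly_Mapping.lookup p (c + (\<Sum>i\<in>Poly_Mapping.keys a. Poly_Mapping.single i (Poly_Mapping.lookup a i)))"
    by (simp add: mpoly_derivs_def)
  moreover have "(\<Sum>i\<in>Poly_Mapping.keys a. Poly_Mapping.single i (Poly_Mapping.lookup a i)) = a"
    by (rule poly_mapping_eqI) (auto simp: lookup_sum_poly_mapping lookup_single when_def in_keys_iff)
  ultimately show ?thesis by simp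
qed

lemma mpoly_derivs_add: "mpoly_derivs a (p + q) = mpoly_derivs a p + mpoly_derivs a q"
  for p q :: "('n, 'a::comm_ring_1) mpoly"
proof -
  obtain C where "\<And>p :: ('n, 'a) mpoly. \<And>c. Poly_Mapping.lookup (mpoly_derivs a p) c = of_nat (C c) * Poly_Mapping.lookup p (c + a)"
    using lookup_mpoly_derivs by blast
  then show ?thesis by (intro poly_mapping_eqI) (simp add: lookup_add distrib_left)
qed

lemma mpoly_derivs_const_mult: "mpoly_derivs a (mpoly_const r * p) = mpoly_const r * mpoly_derivs a p"
  for p :: "('n, 'a::comm_ring_1) mpoly"
proof -
  obtain C where "\<And>p :: ('n, 'a) mpoly. \<And>c. Poly_Mapping.lookup (mpoly_derivs a p) c = of_nat (C c) * Poly_Mapping.lookup p (c + a)"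
    using lookup_mpoly_derivs by blast
  then show ?thesis by (intro poly_mapping_eqI) (simp add: mult.left_commute)
qed

text \<open>A nonzero coefficient at \<open>c\<close> forces \<open>c + a\<close> into the support
  of \<open>p\<close>, which leaves finitely many \<open>a\<close>. So the sum in
  \<open>diff_op\<close> is a genuine finite one.\<close>

lemma finite_mpoly_derivs: "finite {a. mpoly_derivs a p \<noteq> 0}"
  for p :: "('n, 'a::comm_ring_1) mpoly"
proof (rule finite_subset)
  show "finite (\<Union>b\<in>Poly_Mapping.keys p. snd ` {x. fst x + snd x = b})"
    by (auto intro: finite_splittings)
  show "{a. mpoly_derivs a p \<noteq> 0} \<subseteq> (\<Union>b\<in>Poly_Mapping.keys p. snd ` {x. fst x + snd x = b})"
  proof
    fix a assume "a \<in> {a. mpoly_derivs a p \<noteq> 0}"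
    then obtain c where c: "Poly_Mapping.lookup (mpoly_derivs a p) c \<noteq> 0"
      by (auto simp: poly_mapping_eq_iff fun_eq_iff)
    obtain C where "\<And>p :: ('n, 'a) mpoly. \<And>c. Poly_Mapping.lookup (mpoly_derivs a p) c = of_nat (C c) * Poly_Mapping.lookup p (c + a)"
      using lookup_mpoly_derivs by blast
    with c have "c + a \<in> Poly_Mapping.keys p" by (auto simp: in_keys_iff)
    moreover have "a \<in> snd ` {x. fst x + snd x = c + a}" by (auto intro: image_eqI[of _ _ "(c, a)"])
    ultimately show "a \<in> (\<Union>b\<in>Poly_Mapping.keys p. snd ` {x. fst x + snd x = b})" by blast
  qed
qed

lemma diff_op_add: "diff_op F (p + q) = diff_op F p + diff_op F q"
proof -
  have "finite {a. mpoly_const (mps_nth F a) * mpoly_derivs a p \<noteq> 0}" for p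
    by (rule finite_subset[OF _ finite_mpoly_derivs[of p]]) auto
  then show ?thesis
    by (simp add: diff_op_def mpoly_derivs_add distrib_left Sum_any.distrib)
qed

lemma diff_op_const_mult: "diff_op F (mpoly_const r * p) = mpoly_const r * diff_op F p"
proof -
  have "finite {a. mpoly_const (mps_nth F a) * mpoly_derivs a p \<noteq> 0}"
    by (rule finite_subset[OF _ finite_mpoly_derivs[of p]]) auto
  then show ?thesis
    by (simp add: diff_op_def mpoly_derivs_const_mult Sum_any_right_distrib mult.left_commute)
qed

lemma xF_op_add: "xF_op F (p + q) = xF_op F p + xF_op F q"
  by (simp add: xF_op_def diff_op_add distrib_left sum.distrib)

lemma xF_op_const_mult: "xF_op F (mpoly_const r * p) = mpoly_const r * xF_op F p"
  by (simp add: xF_op_def diff_op_const_mult sum_distrib_left mult.left_commute)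

text \<open>A common eigenvector of all \<partial>/\<partial>x is one of every monomial in them. The
  eigenvalues are free of x, so later derivatives pass through them.\<close>

lemma mps_map_mpoly_derivs_eigenvector:
  fixes E :: "('v, ('n, 'a::comm_ring_1) mpoly) mps"
  assumes E: "\<And>i. mps_map (mpoly_deriv i) E = mps_map mpoly_const (k i) * E"
  shows "mps_map (mpoly_derivs a) E = mps_map mpoly_const (\<Prod>i\<in>Poly_Mapping.keys a. k i ^ Poly_Mapping.lookup a i) * E"
proof -
  interpret comp_fun_commute "\<lambda>i. (mpoly_deriv i :: ('n, 'a) mpoly \<Rightarrow> _) ^^ Poly_Mapping.lookup a i"
    by (rule comp_fun_commute_mpoly_derivs)
  note const_mult = mps_map_mult[of mpoly_const, OF mpoly_const_add mpoly_const_mult]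
  \<comment> \<open>The extra factor \<open>A\<close> collects the eigenvalues already produced by
    the other variables in the fold.\<close>
  have pow: "mps_map (mpoly_deriv i ^^ m) (mps_map mpoly_const A * E) = mps_map mpoly_const (k i ^ m * A) * E" for i m A
  proof (induction m)
    case (Suc m)
    have "mps_map (mpoly_deriv i ^^ Suc m) (mps_map mpoly_const A * E) =
        mps_map (mpoly_deriv i) (mps_map (mpoly_deriv i ^^ m) (mps_map mpoly_const A * E))"
      by (rule mps_eqI) simp
    also have "\<dots> = mps_map mpoly_const (k i ^ m * A) * (mps_map mpoly_const (k i) * E)"
      by (simp only: Suc.IH mps_map_additive_mult[of "mpoly_deriv i", OF mpoly_deriv_add mpoly_deriv_const_mult] E)
    also have "\<dots> = mps_map mpoly_const (k i ^ Suc m * A) * E"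
      by (simp add: const_mult mult_ac)
    finally show ?case .
  qed (auto intro: mps_eqI)
  have "mps_map (\<lambda>p. Finite_Set.fold (\<lambda>i. mpoly_deriv i ^^ Poly_Mapping.lookup a i) p S) E =
      mps_map mpoly_const (\<Prod>i\<in>S. k i ^ Poly_Mapping.lookup a i) * E" if "finite S" for S
    using that
  proof (induction S rule: finite_induct)
    case empty
    then show ?case by (auto intro: mps_eqI simp: mps_map_1[of mpoly_const])
  next
    case (insert i S)
    have "mps_map (\<lambda>p. Finite_Set.fold (\<lambda>i. mpoly_deriv i ^^ Poly_Mapping.lookup a i) p (insert i S)) E =
      mps_map (mpoly_deriv i ^^ Poly_Mapping.lookup a i) (mps_map (\<lambda>p. Finite_Set.fold (\<lambda>i. mpoly_deriv i ^^ Poly_Mapping.lookup a i) p S) E)"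
      by (rule mps_eqI) (simp add: insert.hyps)
    then show ?case
      by (simp add: insert.hyps insert.IH pow)
  qed
  from this[of "Poly_Mapping.keys a"] show ?thesis
    unfolding mpoly_derivs_def[abs_def] by simp
qed

section \<open>Series in \<open>\<lambda>\<close> and \<open>q\<close>\<close>

text \<open>Finitely many variables are required by the degree arguments behind local
  finiteness.\<close>

instance lq :: (finite) finite
proof
  have "(UNIV :: 'a lq set) = insert Lam (range Q)"
    by (auto intro: lq.exhaust)
  then show "finite (UNIV :: 'a lq set)" by (metis finite finite_imageI finite_insert)
qed

subsection \<open>The exponential\<close>

lemma locally_finite_mps_exp:
  fixes G :: "('n::finite lq, ('n, 'a::field_char_0) mpoly) mps"
  assumes "mps_nth G 0 = 0"
  shows "locally_finite (\<lambda>m. mps_const (mpoly_const (1 / fact m)) * G ^ m)"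
  by (rule locally_finite_powers) fact

text \<open>The chain rule, stated for any continuous derivation that kills the scalars: it serves
  \<partial>/\<partial>x, \<partial>/\<partial>q, \<partial>/\<partial>\<lambda> and the transport
  defect alike.\<close>

lemma mps_exp_derivation:
  fixes G :: "('n::finite lq, ('n, 'a::field_char_0) mpoly) mps"
  assumes d: "derivation d" "continuous_additive d" "\<And>r. d (mps_const (mpoly_const r)) = 0"
    and G: "mps_nth G 0 = 0"
  shows "d (mps_exp G) = d G * mps_exp G"
proof -
  let ?t = "\<lambda>m. mps_const (mpoly_const (1 / fact m)) * G ^ m"
  \<comment> \<open>Since (k+1)/(k+1)! = 1/k!, differentiating term k+1 yields \<open>d G\<close>
    times term k.\<close>
  have "d (?t m) = case_nat 0 (\<lambda>k. d G * ?t k) m" for m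
  proof (cases m)
    case (Suc k)
    have "of_nat (Suc k) * mps_const (mpoly_const (1 / fact (Suc k))) = (mps_const (mpoly_const (of_nat (Suc k) * (1 / fact (Suc k)))) :: ('n lq, ('n, 'a) mpoly) mps)"
      by (simp only: mpoly_const_mult mps_const_mult mpoly_const_of_nat mps_const_of_nat)
    also have "of_nat (Suc k) * (1 / fact (Suc k)) = (1 / fact k :: 'a)"
      by (simp del: of_nat_Suc)
    finally have k: "of_nat (Suc k) * mps_const (mpoly_const (1 / fact (Suc k))) = (mps_const (mpoly_const (1 / fact k)) :: ('n lq, ('n, 'a) mpoly) mps)" .
    have "d (?t m) = d G * (of_nat (Suc k) * mps_const (mpoly_const (1 / fact (Suc k))) * G ^ k)"
      by (simp add: Suc derivation_mult[OF d(1)] derivation_power[OF d(1)] d(3) mult_ac del: of_nat_Suc fact_Suc power_Suc)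
    then show ?thesis by (simp only: k Suc nat.case)
  qed (simp add: derivation_mult[OF d(1)] derivation_1[OF d(1)] d(3))
  then have "d (mps_exp G) = mps_sum (case_nat 0 (\<lambda>k. d G * ?t k))"
    unfolding mps_exp_def continuous_additive_mps_sum[OF d(2) locally_finite_mps_exp[OF G]] by presburger
  also have "\<dots> = d G * mps_exp G"
    unfolding mps_exp_def mps_sum_case_nat
    by (rule continuous_additive_mps_sum[OF continuous_additive_mult locally_finite_mps_exp[OF G], symmetric])
  finally show ?thesis .
qed

lemma mps_nth_lin_x_0: "(\<And>j. mps_nth (K j) 0 = 0) \<Longrightarrow> mps_nth (lin_x K) 0 = 0"
  by (simp add: lin_x_def mult.commute[of _ "mps_const _"])

text \<open>The derivative of \<open>lin_x K\<close> in x_i is \<open>K i\<close>, so the chain rule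
  applies. This feeds both the eigenvector lemma and the recovery of an exponent from its
  exponential.\<close>

lemma mps_map_mpoly_deriv_mps_exp_lin_x:
  fixes K :: "'n::finite \<Rightarrow> ('n lq, 'a::field_char_0) mps"
  assumes "\<And>j. mps_nth (K j) 0 = 0"
  shows "mps_map (mpoly_deriv i) (mps_exp (lin_x K)) = mps_map mpoly_const (K i) * mps_exp (lin_x K)"
proof -
  have cont: "continuous_additive (mps_map (mpoly_deriv i) :: ('n lq, ('n, 'a) mpoly) mps \<Rightarrow> _)"
    by (rule continuous_additive_map) (rule mpoly_deriv_add)
  have const: "mps_map (mpoly_deriv i) (mps_const p) = mps_const (mpoly_deriv i p)" for p :: "('n, 'a) mpoly"
    by (rule mps_map_const) (simp add: additive_zero mpoly_deriv_add)
  have "mps_map (mpoly_deriv i) (lin_x K) = (\<Sum>j\<in>UNIV. if j = i then mps_map mpoly_const (K j) else 0)"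
    unfolding lin_x_def continuous_additive_sum[OF cont]
      mps_map_additive_mult[of "mpoly_deriv i", OF mpoly_deriv_add mpoly_deriv_const_mult] const
    by (intro sum.cong) (auto simp: mpoly_deriv_var)
  moreover have "derivation (mps_map (mpoly_deriv i) :: ('n lq, ('n, 'a) mpoly) mps \<Rightarrow> _)"
    by (rule derivation_mps_map) (rule mpoly_deriv_add derivation_mpoly_deriv)+
  ultimately show ?thesis
    using mps_exp_derivation[OF _ cont _ mps_nth_lin_x_0[OF assms]] by (simp add: const)
qed

text \<open>Taking the coefficient at \<open>x = 0\<close> after applying \<open>\<partial>/\<partial>x\<^sub>j\<close> recovers the exponent from the exponential.\<close>

lemma mps_exp_lin_x_inj:
  fixes K K' :: "'n::finite \<Rightarrow> ('n lq, 'a::field_char_0) mps"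
  assumes K: "\<And>j. mps_nth (K j) 0 = 0" and K': "\<And>j. mps_nth (K' j) 0 = 0"
    and eq: "mps_exp (lin_x K) = mps_exp (lin_x K')"
  shows "K = K'"
proof -
  \<comment> \<open>Evaluation at x = 0, a ring homomorphism. It sends \<open>lin_x H\<close> to 0
    and the exponential to 1, so the eigenvalue equation for \<partial>/\<partial>x_j turns into
    \<open>H j\<close>.\<close>
  define \<epsilon> :: "('n, 'a) mpoly \<Rightarrow> 'a" where "\<epsilon> p = Poly_Mapping.lookup p 0" for p
  have add: "\<epsilon> (p + q) = \<epsilon> p + \<epsilon> q" and mult: "\<epsilon> (p * q) = \<epsilon> p * \<epsilon> q" and one: "\<epsilon> 1 = 1" for p q
    by (simp_all add: \<epsilon>_def lookup_add lookup_mult_0 lookup_one)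
  have const: "\<epsilon> (mpoly_const r) = r" for r
    by (simp add: \<epsilon>_def mpoly_const_def)
  have zero: "\<epsilon> 0 = 0" by (simp add: \<epsilon>_def)
  have cont: "continuous_additive (mps_map \<epsilon> :: ('n lq, ('n, 'a) mpoly) mps \<Rightarrow> _)"
    by (rule continuous_additive_map) (rule add)
  note hom = mps_map_mult[of \<epsilon>, OF add mult]
  have exp1: "mps_map \<epsilon> (mps_exp (lin_x H)) = 1" if H: "\<And>j. mps_nth (H j) 0 = 0" for H :: "'n \<Rightarrow> ('n lq, 'a) mps"
  proof -
    have "\<epsilon> (mpoly_var j) = 0" for j
      by (simp add: \<epsilon>_def mpoly_var_def lookup_single when_def)
        (metis lookup_single_eq lookup_zero nat.distinct(1))
    then have "mps_map \<epsilon> (lin_x H) = 0"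
      unfolding lin_x_def continuous_additive_sum[OF cont] hom mps_map_const[of \<epsilon>, OF zero] by simp
    then have "mps_map \<epsilon> (mps_exp (lin_x H)) = mps_sum (\<lambda>m. mps_const (1 / fact m) * 0 ^ m :: ('n lq, 'a) mps)"
      unfolding mps_exp_def continuous_additive_mps_sum[OF cont locally_finite_mps_exp[OF mps_nth_lin_x_0[OF H]]]
        hom mps_map_const[of \<epsilon>, OF zero] const mps_map_power[of \<epsilon>, OF add mult one] by simp
    also have "\<dots> = 1"
      by (subst mps_sum_single[where k = 0]) (auto simp: power_0_left)
    finally show ?thesis .
  qed
  have "mps_map \<epsilon> (mps_map (mpoly_deriv j) (mps_exp (lin_x H))) = H j"
    if H: "\<And>j. mps_nth (H j) 0 = 0" for H :: "'n \<Rightarrow> ('n lq, 'a) mps" and j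
  proof -
    have "mps_map \<epsilon> (mps_map mpoly_const (H j)) = H j"
      by (rule mps_eqI) (simp add: const)
    then show ?thesis
      by (simp add: mps_map_mpoly_deriv_mps_exp_lin_x[of H, OF H] hom exp1[of H, OF H])
  qed
  from this[of K, OF K] this[of K', OF K'] show ?thesis by (simp add: fun_eq_iff eq)
qed

subsection \<open>Restriction to \<open>\<lambda> = 0\<close>\<close>

text \<open>The restriction stays in the ring of series in \<lambda> and q, so it is an endomorphism
  and can be compared directly with series free of \<lambda>.\<close>

definition at_lambda_0 :: "('n lq, 'a::comm_ring_1) mps \<Rightarrow> ('n lq, 'a) mps" where
  "at_lambda_0 A = Abs_mps (\<lambda>c. if Poly_Mapping.lookup c Lam = 0 then mps_nth A c else 0)"

lemma mps_nth_at_lambda_0 [simp]: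
  "mps_nth (at_lambda_0 A) c = (if Poly_Mapping.lookup c Lam = 0 then mps_nth A c else 0)"
  by (simp add: at_lambda_0_def)

text \<open>A sum of exponents is free of \<lambda> exactly when both summands are.\<close>

lemma at_lambda_0_mult: "at_lambda_0 (A * B) = at_lambda_0 A * at_lambda_0 B"
proof (rule mps_eqI)
  fix c :: "'a lq \<Rightarrow>\<^sub>0 nat"
  show "mps_nth (at_lambda_0 (A * B)) c = mps_nth (at_lambda_0 A * at_lambda_0 B) c"
  proof (cases "Poly_Mapping.lookup c Lam = 0")
    case True
    then show ?thesis
      by (auto simp: mps_nth_mult lookup_add intro!: sum.cong)
  next
    case False
    then show ?thesis
      by (auto simp: mps_nth_mult lookup_add intro!: sum.neutral)
  qed
qed

lemma at_lambda_0_const [simp]: "at_lambda_0 (mps_const r) = mps_const r"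
  by (rule mps_eqI) (simp add: mps_nth_const)

lemma at_lambda_0_1 [simp]: "at_lambda_0 1 = 1"
  using at_lambda_0_const[of 1] by simp

lemma at_lambda_0_0 [simp]: "at_lambda_0 0 = 0"
  by (rule mps_eqI) simp

lemma at_lambda_0_sum: "at_lambda_0 (sum f S) = (\<Sum>i\<in>S. at_lambda_0 (f i))"
  by (rule mps_eqI) simp

lemma at_lambda_0_diff: "at_lambda_0 (A - B) = at_lambda_0 A - at_lambda_0 B"
  by (rule mps_eqI) simp

lemma at_lambda_0_power: "at_lambda_0 (A ^ m) = at_lambda_0 A ^ m"
  by (induction m) (simp_all add: at_lambda_0_mult)

lemma at_lambda_0_prod: "at_lambda_0 (prod f S) = (\<Prod>i\<in>S. at_lambda_0 (f i))"
  by (induction S rule: infinite_finite_induct) (simp_all add: at_lambda_0_mult)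

lemma at_lambda_0_mps_sum: "at_lambda_0 (mps_sum f) = mps_sum (\<lambda>i. at_lambda_0 (f i))"
  by (rule mps_eqI) (simp add: mps_nth_mps_sum)

lemma at_lambda_0_Lam [simp]: "at_lambda_0 (mps_var Lam) = 0"
  by (rule mps_eqI) (simp add: mps_nth_var)

lemma at_lambda_0_Q [simp]: "at_lambda_0 (mps_var (Q j)) = mps_var (Q j)"
  by (rule mps_eqI) (simp add: mps_nth_var lookup_single)

lemma at_lambda_0_deriv_Q: "at_lambda_0 (mps_deriv (Q i) A) = mps_deriv (Q i) (at_lambda_0 A)"
  by (rule mps_eqI) (simp add: mps_nth_deriv lookup_add lookup_single)

lemma at_lambda_0_map: "\<phi> 0 = 0 \<Longrightarrow> at_lambda_0 (mps_map \<phi> A) = mps_map \<phi> (at_lambda_0 A)"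
  by (rule mps_eqI) simp

lemma at_lambda_0_mps_subst: "at_lambda_0 (mps_subst A G) = mps_subst A (\<lambda>v. at_lambda_0 (G v))"
  by (simp add: mps_subst_def at_lambda_0_mps_sum at_lambda_0_mult at_lambda_0_prod at_lambda_0_power)

lemma at_lambda_0_mps_exp: "at_lambda_0 (mps_exp G) = mps_exp (at_lambda_0 G)"
  by (simp add: mps_exp_def at_lambda_0_mps_sum at_lambda_0_mult at_lambda_0_power)

lemma at_lambda_0_lin_x: "at_lambda_0 (lin_x K) = lin_x (\<lambda>j. at_lambda_0 (K j))"
  by (simp add: lin_x_def at_lambda_0_sum at_lambda_0_mult at_lambda_0_map)

text \<open>Links the boundary condition, phrased as substitution of 0 for \<lambda>, with
  \<open>at_lambda_0\<close>: monomials containing \<lambda> vanish under the substitution.\<close>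

lemma mps_subst_lambda_0:
  "mps_subst A (case_lq 0 G) = mps_subst (at_lambda_0 A) (case_lq 0 G)"
proof -
  have "mps_const (mps_nth A a) * (\<Prod>v\<in>Poly_Mapping.keys a. (case_lq 0 G v) ^ Poly_Mapping.lookup a v)
      = mps_const (mps_nth (at_lambda_0 A) a) * (\<Prod>v\<in>Poly_Mapping.keys a. (case_lq 0 G v) ^ Poly_Mapping.lookup a v)" for a
  proof (cases "Poly_Mapping.lookup a Lam = 0")
    case False
    then have "(\<Prod>v\<in>Poly_Mapping.keys a. (case_lq 0 G v) ^ Poly_Mapping.lookup a v) = 0"
      by (intro prod_zero bexI[of _ Lam]) (auto simp: in_keys_iff power_0_left)
    then show ?thesis by simp
  qed simp
  then show ?thesis by (simp add: mps_subst_def)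
qed

lemma mps_subst_var: "mps_subst (mps_var v) G = G v"
proof -
  have "mps_subst (mps_var v) G = mps_const (mps_nth (mps_var v) (Poly_Mapping.single v 1)) *
     (\<Prod>w\<in>Poly_Mapping.keys (Poly_Mapping.single v (1::nat)). G w ^ Poly_Mapping.lookup (Poly_Mapping.single v 1) w)"
    unfolding mps_subst_def by (rule mps_sum_single) (simp add: mps_nth_var)
  then show ?thesis by (simp add: mps_nth_var)
qed

subsection \<open>The transport equation\<close>

text \<open>The vector field L for arbitrary coefficients \<open>f\<close> and an arbitrary
  coefficient ring, since it is used over k and over k[x].\<close>

definition transport :: "('n::finite \<Rightarrow> ('n lq, 'a::comm_ring_1) mps) \<Rightarrow> ('n lq, 'a) mps \<Rightarrow> ('n lq, 'a) mps" where
  "transport f A = (\<Sum>i\<in>UNIV. f i * mps_deriv (Q i) A)"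

text \<open>The operator \<partial>/\<partial>\<lambda> - L; its kernel consists of the solutions of
  the transport equation.\<close>

definition transport_defect :: "('n::finite \<Rightarrow> ('n lq, 'a::comm_ring_1) mps) \<Rightarrow> ('n lq, 'a) mps \<Rightarrow> ('n lq, 'a) mps" where
  "transport_defect f A = mps_deriv Lam A - transport f A"

lemma derivation_transport: "derivation (transport f)"
  unfolding transport_def[abs_def] by (rule derivation_sum_scaled) (rule derivation_mps_deriv)

lemma continuous_additive_transport: "continuous_additive (transport f)"
  unfolding transport_def[abs_def]
  by (intro continuous_additive_Sum continuous_additive_compose[OF continuous_additive_mult continuous_additive_deriv]) simp

lemma derivation_transport_defect: "derivation (transport_defect f)"
  unfolding transport_defect_def[abs_def]
  by (intro derivation_minus derivation_mps_deriv derivation_transport)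

lemma continuous_additive_transport_defect: "continuous_additive (transport_defect f)"
  unfolding transport_defect_def[abs_def]
  by (intro continuous_additive_minus continuous_additive_deriv continuous_additive_transport)

lemma transport_const [simp]: "transport f (mps_const r) = 0"
  by (simp add: transport_def)

lemma transport_Lam [simp]: "transport f (mps_var Lam) = 0"
  by (simp add: transport_def mps_deriv_var)

lemma transport_Q [simp]: "transport f (mps_var (Q j)) = f j"
proof -
  have "transport f (mps_var (Q j)) = (\<Sum>i\<in>UNIV. if i = j then f i else 0)"
    unfolding transport_def by (intro sum.cong) (auto simp: mps_deriv_var)
  then show ?thesis by simp
qed

lemma transport_defect_const [simp]: "transport_defect f (mps_const r) = 0"
  by (simp add: transport_defect_def)

lemma at_lambda_0_transport:
  "(\<And>i. at_lambda_0 (f i) = f i) \<Longrightarrow> at_lambda_0 (transport f A) = transport f (at_lambda_0 A)"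
  by (simp add: transport_def at_lambda_0_sum at_lambda_0_mult at_lambda_0_deriv_Q)

lemma mps_deriv_Lam_transport:
  assumes "\<And>i. mps_deriv Lam (f i) = 0"
  shows "mps_deriv Lam (transport f A) = transport f (mps_deriv Lam A)"
  by (simp add: transport_def continuous_additive_sum[OF continuous_additive_deriv]
      derivation_mult[OF derivation_mps_deriv] assms mps_deriv_commute[of Lam])

lemma transport_map_const:
  "transport (\<lambda>i. mps_map mpoly_const (f i)) (mps_map mpoly_const A) = mps_map mpoly_const (transport f A)"
  by (simp add: transport_def mps_deriv_map[of mpoly_const, OF mpoly_const_add]
      continuous_additive_sum[OF continuous_additive_map[of mpoly_const, OF mpoly_const_add]]
      mps_map_mult[of mpoly_const, OF mpoly_const_add mpoly_const_mult])

lemma transport_defect_map_const: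
  "transport_defect (\<lambda>i. mps_map mpoly_const (f i)) (mps_map mpoly_const A) = mps_map mpoly_const (transport_defect f A)"
  by (simp add: transport_defect_def transport_map_const mps_deriv_map[of mpoly_const, OF mpoly_const_add]
      continuous_additive_diff[OF continuous_additive_map[of mpoly_const, OF mpoly_const_add]])

text \<open>The difference \<open>W\<close> satisfies \<partial>W/\<partial>\<lambda> = LW. This
  determines the coefficients of \<lambda>-degree m+1, up to the cancellable factor m+1, from those
  of degree at most m, and degree 0 is the initial condition.\<close>

lemma transport_defect_unique:
  fixes U :: "('n::finite lq, 'a::comm_ring_1) mps"
  assumes cancel: "\<And>m (r :: 'a). of_nat (Suc m) * r = 0 \<Longrightarrow> r = 0"
    and defect: "transport_defect f U = transport_defect f V" and initial: "at_lambda_0 U = at_lambda_0 V"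
  shows "U = V"
proof -
  define W where "W = U - V"
  have W: "mps_deriv Lam W = transport f W" "at_lambda_0 W = 0"
    using defect initial continuous_additive_diff[OF continuous_additive_transport_defect[of f], of U V]
    by (auto simp: W_def at_lambda_0_diff transport_defect_def)
  have "mps_nth W c = 0" for c
  proof (induction "Poly_Mapping.lookup c Lam" arbitrary: c rule: less_induct)
    case less
    show ?case
    proof (cases "Poly_Mapping.lookup c Lam")
      case 0
      then show ?thesis using W(2) mps_nth_at_lambda_0[of W c] by simp
    next
      case (Suc m)
      define b where "b = c - Poly_Mapping.single Lam 1"
      have c: "c = b + Poly_Mapping.single Lam 1" and b: "Poly_Mapping.lookup b Lam = m"
        using Suc by (auto simp: b_def lookup_add lookup_minus lookup_single when_def intro!: poly_mapping_eqI)
      \<comment> \<open>\<partial>/\<partial>q_i leaves the \<lambda>-degree unchanged, and a factor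
        \<open>f i\<close> can only use up part of it. So all coefficients of \<open>W\<close>
        entering LW at \<open>b\<close> have \<lambda>-degree at most \<open>m\<close>.\<close>
      have "mps_nth W (snd p + Poly_Mapping.single (Q i) 1) = 0" if p: "fst p + snd p = b" for p i
      proof (rule less)
        have "Poly_Mapping.lookup (snd p) Lam \<le> m"
          using b by (auto simp: lookup_add simp flip: p)
        then show "Poly_Mapping.lookup (snd p + Poly_Mapping.single (Q i) 1) Lam < Poly_Mapping.lookup c Lam"
          by (simp add: Suc lookup_add lookup_single)
      qed
      then have "mps_nth (transport f W) b = 0"
        by (simp add: transport_def mps_nth_mult mps_nth_deriv)
      then have "of_nat (Suc m) * mps_nth W c = 0"
        by (simp add: mps_nth_deriv b c flip: W(1))
      then show ?thesis by (rule cancel)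
    qed
  qed
  then show ?thesis by (intro mps_eqI) (simp add: W_def)
qed

section \<open>Exponential series in \<lambda> as solutions of the transport equation\<close>

lemma locally_finite_exp_series:
  fixes E :: "nat \<Rightarrow> ('n::finite lq, 'a::comm_ring_1) mps"
  shows "locally_finite (\<lambda>m. mps_const (u m) * mps_var Lam ^ m * E m)"
proof -
  from locally_finite_powers[OF mps_nth_var_0[of Lam], of "\<lambda>m. mps_const (u m) * E m"] show ?thesis
    by (simp only: mult.assoc mult.commute[of "E _"])
qed

text \<open>\<partial>/\<partial>\<lambda> of term m+1 equals L of term m. Here \<open>u m\<close>
  stands for 1/m!, as a scalar or a constant polynomial, and \<open>E m\<close> only has to satisfy
  the recursion of iterates of L, so it may arise from another operator.\<close>

lemma transport_defect_exp_series:
  fixes E :: "nat \<Rightarrow> ('n::finite lq, 'a::comm_ring_1) mps"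
  assumes u: "\<And>m. of_nat (Suc m) * u (Suc m) = u m"
    and E: "\<And>m. mps_deriv Lam (E m) = 0" "\<And>m. transport f (E m) = E (Suc m)"
  shows "transport_defect f (mps_sum (\<lambda>m. mps_const (u m) * mps_var Lam ^ m * E m)) = 0"
proof -
  define t where "t m = mps_const (u m) * mps_var Lam ^ m * E m" for m
  define g where "g m = mps_const (u m) * mps_var Lam ^ m * E (Suc m)" for m
  have lf: "locally_finite t"
    unfolding t_def by (rule locally_finite_exp_series)
  have "mps_deriv Lam (t m) = case_nat 0 g m" for m
  proof (cases m)
    case (Suc k)
    have "of_nat (Suc k) * mps_const (u (Suc k)) = (mps_const (u k) :: ('n lq, 'a) mps)"
      by (simp only: u flip: mps_const_of_nat mps_const_mult)
    then have k: "of_nat (Suc k) * mps_const (u (Suc k)) = (mps_const (u k) :: ('n lq, 'a) mps)" .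
    have "mps_deriv Lam (t m) = of_nat (Suc k) * mps_const (u (Suc k)) * mps_var Lam ^ k * E (Suc k)"
      by (simp add: Suc t_def derivation_mult[OF derivation_mps_deriv] derivation_power[OF derivation_mps_deriv]
          E mps_deriv_var mult_ac del: of_nat_Suc power_Suc)
    then show ?thesis by (simp only: k Suc nat.case g_def)
  qed (simp add: t_def derivation_mult[OF derivation_mps_deriv] E)
  then have "mps_deriv Lam (mps_sum t) = mps_sum (case_nat 0 g)"
    unfolding continuous_additive_mps_sum[OF continuous_additive_deriv lf] by presburger
  moreover have "transport f (t m) = g m" for m
    by (simp add: t_def g_def derivation_mult[OF derivation_transport] derivation_power[OF derivation_transport] E)
  then have "transport f (mps_sum t) = mps_sum g"
    by (simp add: continuous_additive_mps_sum[OF continuous_additive_transport lf])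
  ultimately show ?thesis
    by (simp add: transport_defect_def mps_sum_case_nat flip: t_def)
qed

lemma at_lambda_0_exp_series:
  assumes "u 0 = 1"
  shows "at_lambda_0 (mps_sum (\<lambda>m. mps_const (u m) * mps_var Lam ^ m * E m)) = at_lambda_0 (E 0)"
  unfolding at_lambda_0_mps_sum
  by (subst mps_sum_single[where k = 0])
    (auto simp: at_lambda_0_mult at_lambda_0_power assms power_0_left)

text \<open>On e^(qx), \<partial>/\<partial>x_i acts as multiplication by q_i and
  \<partial>/\<partial>q_i as multiplication by x_i. So the sum of the x_i F_i(\<partial>) acts as
  the sum of the F_i(q) \<partial>/\<partial>q_i.\<close>

lemma mps_map_xF_op_transport:
  fixes F :: "'n::finite \<Rightarrow> ('n, 'a::field_char_0) mps"
  defines "E \<equiv> mps_exp (lin_x (\<lambda>j. mps_var (Q j)))"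
  shows "mps_map (xF_op F) E = transport (\<lambda>i. mps_map mpoly_const (mps_subst (F i) (\<lambda>l. mps_var (Q l)))) E"
proof -
  define q where "q a = (\<Prod>i\<in>Poly_Mapping.keys a. mps_var (Q i) ^ Poly_Mapping.lookup a i :: ('n lq, 'a) mps)"
    for a :: "'n \<Rightarrow>\<^sub>0 nat"
  have derivs: "mps_map (mpoly_derivs a) E = mps_map mpoly_const (q a) * E" for a
    unfolding q_def E_def
    by (intro mps_map_mpoly_derivs_eigenvector mps_map_mpoly_deriv_mps_exp_lin_x mps_nth_var_0)
  have cont: "continuous_additive (mps_map mpoly_const :: ('n lq, 'a) mps \<Rightarrow> ('n lq, ('n, 'a) mpoly) mps)"
    by (rule continuous_additive_map) (rule mpoly_const_add)
  note hom = mps_map_mult[of mpoly_const, OF mpoly_const_add mpoly_const_mult]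
  have diff: "mps_map (diff_op (F i)) E = mps_map mpoly_const (mps_subst (F i) (\<lambda>l. mps_var (Q l))) * E" for i
  proof -
    let ?t = "\<lambda>a. mps_const (mps_nth (F i) a) * q a"
    have lf: "locally_finite ?t"
      unfolding q_def by (rule locally_finite_monomials) (rule mps_nth_var_0)
    \<comment> \<open>Continuity moves multiplication by \<open>E\<close> inside the sum defining
      F_i(q). Each q-monomial times \<open>E\<close> is then a derivative of \<open>E\<close>, and
      coefficientwise the sum is the one in \<open>diff_op\<close>.\<close>
    have "continuous_additive (\<lambda>A. E * mps_map mpoly_const A)"
      by (rule continuous_additive_compose[OF continuous_additive_mult cont])
    from continuous_additive_mps_sum[OF this lf]
    have "E * mps_map mpoly_const (mps_subst (F i) (\<lambda>l. mps_var (Q l))) = mps_sum (\<lambda>a. E * mps_map mpoly_const (?t a))"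
      unfolding mps_subst_def q_def .
    also have "\<dots> = mps_sum (\<lambda>a. mps_const (mpoly_const (mps_nth (F i) a)) * mps_map (mpoly_derivs a) E)"
      by (simp add: hom derivs mps_map_const mult_ac)
    also have "\<dots> = mps_map (diff_op (F i)) E"
      by (rule mps_eqI) (simp add: mps_nth_mps_sum diff_op_def)
    finally show ?thesis by (simp add: mult.commute)
  qed
  have deriv: "mps_deriv (Q i) E = mps_const (mpoly_var i) * E" for i
  proof -
    have "mps_deriv (Q i) (lin_x (\<lambda>j. mps_var (Q j)) :: ('n lq, ('n, 'a) mpoly) mps) =
        (\<Sum>j\<in>UNIV. if j = i then mps_const (mpoly_var j) else 0)"
      unfolding lin_x_def continuous_additive_sum[OF continuous_additive_deriv]
      by (intro sum.cong) (auto simp: derivation_mult[OF derivation_mps_deriv] mps_map_var mps_deriv_var)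
    then show ?thesis
      unfolding E_def
      by (subst mps_exp_derivation[OF derivation_mps_deriv continuous_additive_deriv])
        (simp_all add: mps_nth_lin_x_0)
  qed
  have "mps_map (xF_op F) E = (\<Sum>i\<in>UNIV. mps_const (mpoly_var i) * mps_map (diff_op (F i)) E)"
    by (rule mps_eqI) (simp add: xF_op_def)
  then show ?thesis
    by (simp add: transport_def diff deriv mult_ac)
qed

text \<open>\<open>xF_op F\<close> acts on x and is k-linear, while the transport differentiates in
  q with coefficients free of x.\<close>

lemma mps_map_xF_op_commute_transport:
  "mps_map (xF_op F) (transport (\<lambda>i. mps_map mpoly_const (f i)) A) =
    transport (\<lambda>i. mps_map mpoly_const (f i)) (mps_map (xF_op F) A)"
  by (simp add: transport_def mps_deriv_map[of "xF_op F", OF xF_op_add]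
      continuous_additive_sum[OF continuous_additive_map[of "xF_op F", OF xF_op_add]]
      mps_map_additive_mult[of "xF_op F", OF xF_op_add xF_op_const_mult])

section \<open>Existence and uniqueness of the exponent, its two flow equations and its initial
  value\<close>

theorem mainTheorem7:
  fixes F :: "'n::finite \<Rightarrow> ('n, 'a::field_char_0) mps"
  shows "(\<exists>!K. is_exponent F K) \<and>
    (\<forall>K. is_exponent F K \<longrightarrow>
      (\<forall>j. mps_subst (F j) K =
             (\<Sum>i\<in>UNIV. mps_subst (F i) (\<lambda>l. mps_var (Q l)) * mps_deriv (Q i) (K j)) \<and>
           (\<Sum>i\<in>UNIV. mps_subst (F i) (\<lambda>l. mps_var (Q l)) * mps_deriv (Q i) (K j)) =
             mps_deriv Lam (K j) \<and>
           mps_subst (K j) (case_lq 0 mps_var) = (mps_var j :: ('n, 'a) mps)))"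
proof -
  define f :: "'n \<Rightarrow> ('n lq, 'a) mps" where "f i = mps_subst (F i) (\<lambda>l. mps_var (Q l))" for i
  \<comment> \<open>The flow of L applied to the coordinates: the exponential of \<lambda>L at
    q_j.\<close>
  define K :: "'n \<Rightarrow> ('n lq, 'a) mps" where
    "K j = mps_sum (\<lambda>m. mps_const (1 / fact m) * mps_var Lam ^ m * (transport f ^^ m) (mps_var (Q j)))" for j
  have const_cont: "continuous_additive (mps_map mpoly_const :: ('n lq, 'a) mps \<Rightarrow> ('n lq, ('n, 'a) mpoly) mps)"
    by (rule continuous_additive_map) (rule mpoly_const_add)

  \<comment> \<open>Such a \<open>d\<close> kills every monomial in the \<open>G v\<close>, hence by
    continuity the whole series. It is used for \<partial>/\<partial>\<lambda> with q substituted
    and for the transport defect with \<open>K\<close> substituted.\<close>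
  have subst_defect: "d (mps_subst A G) = 0"
    if "derivation d" "continuous_additive d" "\<And>r. d (mps_const r) = 0"
      "\<And>v. d (G v) = 0" "\<And>v. mps_nth (G v) 0 = 0"
    for d :: "('n lq, 'a) mps \<Rightarrow> ('n lq, 'a) mps" and A :: "('n, 'a) mps" and G
  proof -
    have "d (\<Prod>v\<in>Poly_Mapping.keys a. G v ^ Poly_Mapping.lookup a v) = 0" for a
      by (rule derivation_prod_zero) (simp_all add: that derivation_power[OF that(1)])
    then show ?thesis
      unfolding mps_subst_def continuous_additive_mps_sum[OF that(2) locally_finite_monomials[OF that(5)]]
      by (subst mps_sum_single) (simp_all add: derivation_mult[OF that(1)] that(3))
  qed

  have f_Lam: "mps_deriv Lam (f i) = 0" for i
    unfolding f_def
    by (rule subst_defect) (simp_all add: derivation_mps_deriv continuous_additive_deriv mps_deriv_var)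
  have f_0: "at_lambda_0 (f i) = f i" for i
    by (simp add: f_def at_lambda_0_mps_subst)
  have K_defect: "transport_defect f (K j) = 0" for j
    unfolding K_def
  proof (rule transport_defect_exp_series)
    show "mps_deriv Lam ((transport f ^^ m) (mps_var (Q j))) = 0" for m
      by (induction m)
        (simp_all add: mps_deriv_var mps_deriv_Lam_transport f_Lam continuous_additive_zero[OF continuous_additive_transport])
  qed (simp_all del: of_nat_Suc)
  have K_initial: "at_lambda_0 (K j) = mps_var (Q j)" for j
    unfolding K_def by (subst at_lambda_0_exp_series) simp_all
  have K0: "mps_nth (K j) 0 = 0" for j
    using mps_nth_at_lambda_0[of "K j" 0] by (simp add: K_initial)

  \<comment> \<open>The coefficients of L moved into k[x][[\<lambda>,q]], so that L acts on the
    exponentials as well.\<close>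
  define f' :: "'n \<Rightarrow> ('n lq, ('n, 'a) mpoly) mps" where "f' i = mps_map mpoly_const (f i)" for i
  define E :: "('n lq, ('n, 'a) mpoly) mps" where "E = mps_exp (lin_x (\<lambda>j. mps_var (Q j)))"
  have E_0: "at_lambda_0 E = E"
    by (simp add: E_def at_lambda_0_mps_exp at_lambda_0_lin_x)
  have E_Lam: "mps_deriv Lam E = 0"
  proof -
    have "mps_deriv Lam (lin_x (\<lambda>j. mps_var (Q j)) :: ('n lq, ('n, 'a) mpoly) mps) = 0"
      unfolding lin_x_def continuous_additive_sum[OF continuous_additive_deriv]
      by (simp add: derivation_mult[OF derivation_mps_deriv] mps_map_var mps_deriv_var)
    then show ?thesis
      unfolding E_def
      by (subst mps_exp_derivation[OF derivation_mps_deriv continuous_additive_deriv])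
        (simp_all add: mps_nth_lin_x_0)
  qed
  have f'_Lam: "mps_deriv Lam (f' i) = 0" for i
    by (simp add: f'_def mps_deriv_map[of mpoly_const, OF mpoly_const_add] f_Lam continuous_additive_zero[OF const_cont])
  have D_E: "mps_map (xF_op F) E = transport f' E"
    unfolding E_def f'_def f_def by (rule mps_map_xF_op_transport)
  have D_commute: "mps_map (xF_op F) (transport f' A) = transport f' (mps_map (xF_op F) A)" for A
    unfolding f'_def by (rule mps_map_xF_op_commute_transport)
  \<comment> \<open>L commutes with D = \<open>xF_op F\<close> and agrees with it on
    \<open>E\<close>. So the powers of D on \<open>E\<close> obey the recursion for iterates of
    L.\<close>
  have transport_D: "transport f' ((mps_map (xF_op F) ^^ m) E) = (mps_map (xF_op F) ^^ Suc m) E" for m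
    by (induction m) (simp_all add: D_E flip: D_commute)
  have D_Lam: "mps_deriv Lam ((mps_map (xF_op F) ^^ m) E) = 0" for m
    by (induction m)
      (simp_all add: E_Lam mps_deriv_map[of "xF_op F", OF xF_op_add]
        continuous_additive_zero[OF continuous_additive_map[of "xF_op F", OF xF_op_add]])

  \<comment> \<open>Both sides lie in the kernel of the transport defect for \<open>f'\<close> and
    restrict to \<open>E\<close> at \<lambda> = 0.\<close>
  have "mps_exp (lin_x K) = exp_lambda_op (xF_op F) E"
  proof (rule transport_defect_unique)
    show "of_nat (Suc m) * r = 0 \<Longrightarrow> r = 0" for m and r :: "('n, 'a) mpoly"
      by (rule of_nat_Suc_mult_mpoly_eq_0D)
    have "transport_defect f' (lin_x K) = 0"
      unfolding lin_x_def continuous_additive_sum[OF continuous_additive_transport_defect] f'_def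
      by (simp add: derivation_mult[OF derivation_transport_defect] transport_defect_map_const K_defect
          continuous_additive_zero[OF const_cont])
    then have "transport_defect f' (mps_exp (lin_x K)) = 0"
      by (subst mps_exp_derivation[OF derivation_transport_defect continuous_additive_transport_defect])
        (simp_all add: mps_nth_lin_x_0 K0)
    moreover have "transport_defect f' (exp_lambda_op (xF_op F) E) = 0"
      unfolding exp_lambda_op_def
    proof (rule transport_defect_exp_series)
      show "of_nat (Suc m) * mpoly_const (1 / fact (Suc m)) = (mpoly_const (1 / fact m) :: ('n, 'a) mpoly)" for m
        by (simp flip: mpoly_const_of_nat mpoly_const_mult del: of_nat_Suc)
    qed (rule D_Lam transport_D)+
    ultimately show "transport_defect f' (mps_exp (lin_x K)) = transport_defect f' (exp_lambda_op (xF_op F) E)"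
      by simp
    show "at_lambda_0 (mps_exp (lin_x K)) = at_lambda_0 (exp_lambda_op (xF_op F) E)"
      unfolding exp_lambda_op_def
      by (subst at_lambda_0_exp_series)
        (simp_all add: at_lambda_0_mps_exp at_lambda_0_lin_x K_initial E_0, simp add: E_def)
  qed
  then have K: "is_exponent F K"
    by (simp add: is_exponent_def K0 E_def)
  have K_unique: "K' = K" if "is_exponent F K'" for K'
    by (rule mps_exp_lin_x_inj) (use that K in \<open>simp_all add: is_exponent_def\<close>)

  \<comment> \<open>Again two elements of the kernel with the same restriction to \<lambda> = 0,
    namely \<open>f j\<close>.\<close>
  have flow: "mps_subst (F j) K = transport f (K j)" for j
  proof (rule transport_defect_unique)
    show "of_nat (Suc m) * r = 0 \<Longrightarrow> r = 0" for m and r :: 'a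
      by (simp del: of_nat_Suc)
    have "transport_defect f (mps_subst (F j) K) = 0"
      by (rule subst_defect)
        (simp_all add: derivation_transport_defect continuous_additive_transport_defect K_defect K0)
    \<comment> \<open>L commutes with \<partial>/\<partial>\<lambda> because its coefficients
      \<open>f i\<close> are free of \<lambda>; so L preserves the kernel.\<close>
    moreover have "transport_defect f (transport f (K j)) = transport f (transport_defect f (K j))"
      by (simp add: transport_defect_def mps_deriv_Lam_transport f_Lam continuous_additive_diff[OF continuous_additive_transport])
    ultimately show "transport_defect f (mps_subst (F j) K) = transport_defect f (transport f (K j))"
      by (simp add: K_defect continuous_additive_zero[OF continuous_additive_transport])
    show "at_lambda_0 (mps_subst (F j) K) = at_lambda_0 (transport f (K j))"
      by (simp add: at_lambda_0_mps_subst at_lambda_0_transport f_0 K_initial) (simp add: f_def)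
  qed
  have lambda: "transport f (K j) = mps_deriv Lam (K j)" for j
    using K_defect[of j] by (simp add: transport_defect_def)
  have boundary: "mps_subst (K j) (case_lq 0 mps_var) = (mps_var j :: ('n, 'a) mps)" for j
    by (subst mps_subst_lambda_0) (simp add: K_initial mps_subst_var)
  show ?thesis
  proof (intro conjI allI impI)
    show "\<exists>!K. is_exponent F K"
      using K K_unique by (rule ex1I)
    fix K' j
    assume "is_exponent F K'"
    then have K': "K' = K" by (rule K_unique)
    show "mps_subst (F j) K' = (\<Sum>i\<in>UNIV. mps_subst (F i) (\<lambda>l. mps_var (Q l)) * mps_deriv (Q i) (K' j))"
      using flow[of j] by (simp only: K' transport_def f_def)
    show "(\<Sum>i\<in>UNIV. mps_subst (F i) (\<lambda>l. mps_var (Q l)) * mps_deriv (Q i) (K' j)) = mps_deriv Lam (K' j)"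
      using lambda[of j] by (simp only: K' transport_def f_def)
    show "mps_subst (K' j) (case_lq 0 mps_var) = (mps_var j :: ('n, 'a) mps)"
      unfolding K' by (rule boundary)
  qed
qed

end
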